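(* Let $(\mathcal{E},\mathcal{J},\mathcal{M})$ be a double factorization system on a bicomplete (respectively, finitely bicomplete) category $\mathcal{C}$, let $\mathbb{G}=(G,\epsilon,\delta)$ be a comonad on $\mathcal{C}$, and suppose that the functor $G$ preserves all small (respectively, finite) limits, that $G(\mathcal{M})\subseteq\mathcal{M}$ and that $G(\mathcal{J})\subseteq\mathcal{J}$. Let $G_{\mathbb{G}}\colon\mathcal{C}_{\mathbb{G}}\leftrightarrows\mathcal{C}\colon R_{\mathbb{G}}$ be the forgetful/cofree coalgebra adjunction, and put $\mathcal{E}_{\mathbb{G}}=(G_{\mathbb{G}})^{-1}(\mathcal{E})$, $\mathcal{J}_{\mathbb{G}}=(G_{\mathbb{G}})^{-1}(\mathcal{J})$, $\mathcal{M}_{\mathbb{G}}=(G_{\mathbb{G}})^{-1}(\mathcal{M})$. Then: (i) $(\mathcal{E}_{\mathbb{G}},\mathcal{J}_{\mathbb{G}},\mathcal{M}_{\mathbb{G}})$ is the left-induced double factorization system on $\mathcal{C}_{\mathbb{G}}$ generated by $G_{\mathbb{G}}$; (ii) $G_{\mathbb{G}}$ reflects the corresponding local objects: $G_{\mathbb{G}}^{-1}(\mathcal{C}_{\mathcal{J}\cdot\mathcal{E}})\subseteq(\mathcal{C}_{\mathbb{G}})_{\mathcal{J}_{\mathbb{G}}\cdot\mathcal{E}_{\mathbb{G}}}$; (iii) $G_{\mathbb{G}}$ and $R_{\mathbb{G}}$ preserve the corresponding local objects if and only if $G$ preserves $\mathcal{J}\cdot\mathcal{E}$-local objects, i.e.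 $$\Big(G_{\mathbb{G}}\big((\mathcal{C}_{\mathbb{G}})_{\mathcal{J}_{\mathbb{G}}\cdot\mathcal{E}_{\mathbb{G}}}\big)\subseteq\mathcal{C}_{\mathcal{J}\cdot\mathcal{E}}\ \text{ and }\ R_{\mathbb{G}}(\mathcal{C}_{\mathcal{J}\cdot\mathcal{E}})\subseteq(\mathcal{C}_{\mathbb{G}})_{\mathcal{J}_{\mathbb{G}}\cdot\mathcal{E}_{\mathbb{G}}}\Big)\Longleftrightarrow G(\mathcal{C}_{\mathcal{J}\cdot\mathcal{E}})\subseteq\mathcal{C}_{\mathcal{J}\cdot\mathcal{E}}.$$ In particular, $G_{\mathbb{G}}\colon\mathcal{C}_{\mathbb{G}}\leftrightarrows\mathcal{C}\colon R_{\mathbb{G}}$ is a Quillen adjunction.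
   Context: For classes of morphisms $\mathcal{A},\mathcal{B}$, $\mathcal{B}\cdot\mathcal{A}$ is the class of all composites $ba$ with $a\in\mathcal{A}$, $b\in\mathcal{B}$. Write $f\perp g$ if every commutative square from $f$ to $g$ has a unique diagonal filler; $\mathcal{A}^{\perp}=\{g: f\perp g\ \forall f\in\mathcal{A}\}$. A double factorization system (dfs) on $\mathcal{C}$ is a triple $(\mathcal{E},\mathcal{J},\mathcal{M})$ of classes of morphisms such that: (1) $\mathrm{Iso}\cdot\mathcal{E}\subseteq\mathcal{E}$, $\mathrm{Iso}\cdot\mathcal{J}\cdot\mathrm{Iso}\subseteq\mathcal{J}$, $\mathcal{M}\cdot\mathrm{Iso}\subseteq\mathcal{M}$; (2) every morphism lies in $\mathcal{M}\cdot\mathcal{J}\cdot\mathcal{E}$; (3) for $e\colon A\to B$ in $\mathcal{E}$, $j\colon B\to C$ and $j'\colon D\to E$ in $\mathcal{J}$, $m\colon E\to F$ in $\mathcal{M}$ and $u\colon A\to D$, $v\colon C\to F$ with $vje=mj'u$, there is a unique pair $s\colon B\to D$, $t\colon C\to E$ with $se=u$, $j's=tj$, $mt=v$. Morphisms in $\mathcal{J}$, $\mathcal{M}$ are called bifibrant morphisms and trivial fibrations respectively. $\mathcal{C}_{\mathbb{G}}$ is the category of Eilenberg–Moore coalgebras $(A,s\colon A\to GA)$; $G_{\mathbb{G}}$ is the forgetful functor and $R_{\mathbb{G}}$ its right adjoint $A\mapsto(GA,\delta_A)$. For a functor $V$ and a class $\mathcal{A}$ of morphisms (or of objects), $V^{-1}(\mathcal{A})$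 denotes its preimage. Given an adjunction $F\colon\mathcal{C}\rightleftarrows\mathcal{D}\colon H$ ($F$ left adjoint) and a dfs $(\mathcal{E},\mathcal{J},\mathcal{M})$ on $\mathcal{D}$, the triple $(F^{-1}(\mathcal{E}),F^{-1}(\mathcal{J}),(F^{-1}(\mathcal{J}\cdot\mathcal{E}))^{\perp})$ is called the left-induced dfs if it is a dfs on $\mathcal{C}$. So (i) asserts that $(\mathcal{E}_{\mathbb{G}},\mathcal{J}_{\mathbb{G}},\mathcal{M}_{\mathbb{G}})$ is a dfs on $\mathcal{C}_{\mathbb{G}}$ and equals this triple for $F=G_{\mathbb{G}}$. For a class $\mathcal{L}$ of morphisms in a category $\mathcal{X}$, an object $X$ is $\mathcal{L}$-local if for every $m\colon A\to B$ in $\mathcal{L}$ the map $\mathcal{X}(B,X)\to\mathcal{X}(A,X)$, $g\mapsto gm$, is a bijection; $\mathcal{X}_{\mathcal{L}}$ is the full subcategory of $\mathcal{L}$-local objects. For categories with dfs's, an adjunction $F\colon\mathcal{C}\leftrightarrows\mathcal{D}\colon H$ is a Quillen adjunction if $F(\mathcal{J}_{\mathcal{C}}\cdot\mathcal{E}_{\mathcal{C}})\subseteq\mathcal{J}_{\mathcal{D}}\cdot\mathcal{E}_{\mathcal{D}}$ and $F(\mathcal{E}_{\mathcal{C}})\subseteq\mathcal{E}_{\mathcal{D}}$. Here $\mathcal{C}_{\mathbb{G}}$ carries the dfs of (i). *)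

theory Defs
  imports "HOL-Library.Equipollence"
begin

section \<open>Categories, functors and natural transformations\<close>

record ('o, 'm) category =
  Obj :: "'o set"
  Arr :: "'m set"
  Dom :: "'m \<Rightarrow> 'o"
  Cod :: "'m \<Rightarrow> 'o"
  Ident :: "'o \<Rightarrow> 'm"
  Comp :: "'m \<Rightarrow> 'm \<Rightarrow> 'm"  (infixl "\<cdot>\<index>" 70)

definition hom :: "('o, 'm, 'x) category_scheme \<Rightarrow> 'o \<Rightarrow> 'o \<Rightarrow> 'm set" where
  "hom C A B = {f \<in> Arr C. Dom C f = A \<and> Cod C f = B}"

locale category =
  fixes C :: "('o, 'm) category" (structure)
  assumes Dom_in_Obj: "f \<in> Arr C \<Longrightarrow> Dom C f \<in> Obj C"
    and Cod_in_Obj: "f \<in> Arr C \<Longrightarrow> Cod C f \<in> Obj C"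
    and Ident_in_hom: "A \<in> Obj C \<Longrightarrow> Ident C A \<in> hom C A A"
    and Comp_in_hom: "\<lbrakk>f \<in> hom C A B; g \<in> hom C B D\<rbrakk> \<Longrightarrow> g \<cdot> f \<in> hom C A D"
    and Comp_Ident: "f \<in> hom C A B \<Longrightarrow> f \<cdot> Ident C A = f"
    and Ident_Comp: "f \<in> hom C A B \<Longrightarrow> Ident C B \<cdot> f = f"
    and Comp_assoc: "\<lbrakk>f \<in> hom C A B; g \<in> hom C B D; h \<in> hom C D F\<rbrakk>
      \<Longrightarrow> (h \<cdot> g) \<cdot> f = h \<cdot> (g \<cdot> f)"

definition op_cat :: "('o, 'm) category \<Rightarrow> ('o, 'm) category" where
  "op_cat C = \<lparr>Obj = Obj C, Arr = Arr C, Dom = Cod C, Cod = Dom C, Ident = Ident C,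
     Comp = (\<lambda>g f. f \<cdot>\<^bsub>C\<^esub> g)\<rparr>"

definition isos :: "('o, 'm) category \<Rightarrow> 'm set" where
  "isos C = {f \<in> Arr C. \<exists>g \<in> hom C (Cod C f) (Dom C f).
     g \<cdot>\<^bsub>C\<^esub> f = Ident C (Dom C f) \<and> f \<cdot>\<^bsub>C\<^esub> g = Ident C (Cod C f)}"

record ('o1, 'm1, 'o2, 'm2) funct =
  ObjMap :: "'o1 \<Rightarrow> 'o2"
  ArrMap :: "'m1 \<Rightarrow> 'm2"

locale is_functor = src: category C + tgt: category D
  for C :: "('o1, 'm1) category" and D :: "('o2, 'm2) category"
    and F :: "('o1, 'm1, 'o2, 'm2) funct" +
  assumes ObjMap_in_Obj: "A \<in> Obj C \<Longrightarrow> ObjMap F A \<in> Obj D"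
    and ArrMap_in_hom: "f \<in> hom C A B \<Longrightarrow> ArrMap F f \<in> hom D (ObjMap F A) (ObjMap F B)"
    and ArrMap_Ident: "A \<in> Obj C \<Longrightarrow> ArrMap F (Ident C A) = Ident D (ObjMap F A)"
    and ArrMap_Comp: "\<lbrakk>f \<in> hom C A B; g \<in> hom C B B'\<rbrakk>
      \<Longrightarrow> ArrMap F (g \<cdot>\<^bsub>C\<^esub> f) = ArrMap F g \<cdot>\<^bsub>D\<^esub> ArrMap F f"

definition id_functor :: "('o, 'm, 'o, 'm) funct" where
  "id_functor = \<lparr>ObjMap = (\<lambda>A. A), ArrMap = (\<lambda>f. f)\<rparr>"

definition comp_functor ::
  "('o2, 'm2, 'o3, 'm3) funct \<Rightarrow> ('o1, 'm1, 'o2, 'm2) funct \<Rightarrow> ('o1, 'm1, 'o3, 'm3) funct"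
  where
  "comp_functor H F = \<lparr>ObjMap = ObjMap H \<circ> ObjMap F, ArrMap = ArrMap H \<circ> ArrMap F\<rparr>"

locale nat_trans = src: is_functor C D F + tgt: is_functor C D H
  for C :: "('o1, 'm1) category" and D :: "('o2, 'm2) category"
    and F H :: "('o1, 'm1, 'o2, 'm2) funct" and \<tau> :: "'o1 \<Rightarrow> 'm2" +
  assumes component_in_hom: "A \<in> Obj C \<Longrightarrow> \<tau> A \<in> hom D (ObjMap F A) (ObjMap H A)"
    and naturality: "f \<in> hom C A B
      \<Longrightarrow> \<tau> B \<cdot>\<^bsub>D\<^esub> ArrMap F f = ArrMap H f \<cdot>\<^bsub>D\<^esub> \<tau> A"

text \<open>\<^term>\<open>F\<close> is left adjoint to \<^term>\<open>H\<close> with unit \<^term>\<open>\<eta>\<close> and counit \<^term>\<open>\<kappa>\<close>.\<close>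

locale adjunction =
  left: is_functor C D F + right: is_functor D C H +
  unit: nat_trans C C id_functor "comp_functor H F" \<eta> +
  counit: nat_trans D D "comp_functor F H" id_functor \<kappa>
  for C :: "('o1, 'm1) category" and D :: "('o2, 'm2) category"
    and F :: "('o1, 'm1, 'o2, 'm2) funct" and H :: "('o2, 'm2, 'o1, 'm1) funct"
    and \<eta> :: "'o1 \<Rightarrow> 'm1" and \<kappa> :: "'o2 \<Rightarrow> 'm2" +
  assumes triangle_left: "A \<in> Obj C
      \<Longrightarrow> \<kappa> (ObjMap F A) \<cdot>\<^bsub>D\<^esub> ArrMap F (\<eta> A) = Ident D (ObjMap F A)"
    and triangle_right: "B \<in> Obj D
      \<Longrightarrow> ArrMap H (\<kappa> B) \<cdot>\<^bsub>C\<^esub> \<eta> (ObjMap H B) = Ident C (ObjMap H B)"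


section \<open>Limits and colimits\<close>

definition is_cone ::
  "('i, 'j) category \<Rightarrow> ('o, 'm) category \<Rightarrow> ('i, 'j, 'o, 'm) funct \<Rightarrow> 'o \<Rightarrow> ('i \<Rightarrow> 'm) \<Rightarrow> bool"
  where
  "is_cone I C D L p \<longleftrightarrow> L \<in> Obj C \<and> (\<forall>i \<in> Obj I. p i \<in> hom C L (ObjMap D i)) \<and>
     (\<forall>a \<in> Arr I. ArrMap D a \<cdot>\<^bsub>C\<^esub> p (Dom I a) = p (Cod I a))"

definition is_limit ::
  "('i, 'j) category \<Rightarrow> ('o, 'm) category \<Rightarrow> ('i, 'j, 'o, 'm) funct \<Rightarrow> 'o \<Rightarrow> ('i \<Rightarrow> 'm) \<Rightarrow> bool"
  where
  "is_limit I C D L p \<longleftrightarrow> is_cone I C D L p \<and>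
     (\<forall>N q. is_cone I C D N q \<longrightarrow>
        (\<exists>!h. h \<in> hom C N L \<and> (\<forall>i \<in> Obj I. p i \<cdot>\<^bsub>C\<^esub> h = q i)))"

text \<open>A functor from \<^term>\<open>I\<close> to \<^term>\<open>C\<close> and its opposite have the same underlying maps.\<close>

definition is_colimit ::
  "('i, 'j) category \<Rightarrow> ('o, 'm) category \<Rightarrow> ('i, 'j, 'o, 'm) funct \<Rightarrow> 'o \<Rightarrow> ('i \<Rightarrow> 'm) \<Rightarrow> bool"
  where
  "is_colimit I C D L p \<longleftrightarrow> is_limit (op_cat I) (op_cat C) D L p"

text \<open>
  Smallness is relative to a type \<^typ>\<open>'u\<close> in the role of the universe: the small sets are those
  of cardinality strictly below that of \<^typ>\<open>'u\<close>. The usual meaning is obtained when the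
  cardinality of \<^typ>\<open>'u\<close> is strongly inaccessible. Up to isomorphism every small category
  has its objects and arrows in \<^typ>\<open>'u\<close>, and every finite one has them in \<^typ>\<open>nat\<close>, so it
  is enough to consider diagrams indexed by such categories.
\<close>

definition small_cat :: "('u, 'u) category \<Rightarrow> bool" where
  "small_cat I \<longleftrightarrow> category I \<and> Obj I \<prec> (UNIV :: 'u set) \<and> Arr I \<prec> (UNIV :: 'u set)"

definition finite_cat :: "(nat, nat) category \<Rightarrow> bool" where
  "finite_cat I \<longleftrightarrow> category I \<and> finite (Obj I) \<and> finite (Arr I)"

definition bicomplete :: "'u itself \<Rightarrow> ('o, 'm) category \<Rightarrow> bool" where
  "bicomplete TYPE('u) C \<longleftrightarrow> category C \<and>
     (\<forall>(I :: ('u, 'u) category) D. small_cat I \<and> is_functor I C D \<longrightarrow>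
        (\<exists>L p. is_limit I C D L p) \<and> (\<exists>L p. is_colimit I C D L p))"

definition finitely_bicomplete :: "('o, 'm) category \<Rightarrow> bool" where
  "finitely_bicomplete C \<longleftrightarrow> category C \<and>
     (\<forall>I D. finite_cat I \<and> is_functor I C D \<longrightarrow>
        (\<exists>L p. is_limit I C D L p) \<and> (\<exists>L p. is_colimit I C D L p))"

definition preserves_limits_of_shape ::
  "('i, 'j) category \<Rightarrow> ('o1, 'm1) category \<Rightarrow> ('o2, 'm2) category
     \<Rightarrow> ('o1, 'm1, 'o2, 'm2) funct \<Rightarrow> bool" where
  "preserves_limits_of_shape I C C' F \<longleftrightarrow>
     (\<forall>D L p. is_functor I C D \<and> is_limit I C D L p \<longrightarrow>
        is_limit I C' (comp_functor F D) (ObjMap F L) (\<lambda>i. ArrMap F (p i)))"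

definition preserves_small_limits ::
  "'u itself \<Rightarrow> ('o1, 'm1) category \<Rightarrow> ('o2, 'm2) category
     \<Rightarrow> ('o1, 'm1, 'o2, 'm2) funct \<Rightarrow> bool" where
  "preserves_small_limits TYPE('u) C C' F \<longleftrightarrow>
     (\<forall>I :: ('u, 'u) category. small_cat I \<longrightarrow> preserves_limits_of_shape I C C' F)"

definition preserves_finite_limits ::
  "('o1, 'm1) category \<Rightarrow> ('o2, 'm2) category \<Rightarrow> ('o1, 'm1, 'o2, 'm2) funct \<Rightarrow> bool" where
  "preserves_finite_limits C C' F \<longleftrightarrow>
     (\<forall>I. finite_cat I \<longrightarrow> preserves_limits_of_shape I C C' F)"


section \<open>Classes of morphisms, orthogonality and local objects\<close>

definition class_comp :: "('o, 'm) category \<Rightarrow> 'm set \<Rightarrow> 'm set \<Rightarrow> 'm set" where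
  "class_comp C \<B> \<A> = {b \<cdot>\<^bsub>C\<^esub> a | a b. a \<in> \<A> \<and> b \<in> \<B> \<and> Cod C a = Dom C b}"

definition orthogonal :: "('o, 'm) category \<Rightarrow> 'm \<Rightarrow> 'm \<Rightarrow> bool" where
  "orthogonal C f g \<longleftrightarrow>
     (\<forall>u \<in> hom C (Dom C f) (Dom C g). \<forall>v \<in> hom C (Cod C f) (Cod C g).
        v \<cdot>\<^bsub>C\<^esub> f = g \<cdot>\<^bsub>C\<^esub> u \<longrightarrow>
        (\<exists>!d. d \<in> hom C (Cod C f) (Dom C g) \<and> d \<cdot>\<^bsub>C\<^esub> f = u \<and> g \<cdot>\<^bsub>C\<^esub> d = v))"

definition right_perp :: "('o, 'm) category \<Rightarrow> 'm set \<Rightarrow> 'm set" where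
  "right_perp C \<A> = {g \<in> Arr C. \<forall>f \<in> \<A>. orthogonal C f g}"

definition local_objects :: "('o, 'm) category \<Rightarrow> 'm set \<Rightarrow> 'o set" where
  "local_objects C \<L> = {X \<in> Obj C. \<forall>m \<in> \<L>.
     bij_betw (\<lambda>g. g \<cdot>\<^bsub>C\<^esub> m) (hom C (Cod C m) X) (hom C (Dom C m) X)}"

definition arr_preimage ::
  "('o1, 'm1) category \<Rightarrow> ('o1, 'm1, 'o2, 'm2) funct \<Rightarrow> 'm2 set \<Rightarrow> 'm1 set" where
  "arr_preimage C F \<A> = {f \<in> Arr C. ArrMap F f \<in> \<A>}"

definition obj_preimage ::
  "('o1, 'm1) category \<Rightarrow> ('o1, 'm1, 'o2, 'm2) funct \<Rightarrow> 'o2 set \<Rightarrow> 'o1 set" where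
  "obj_preimage C F \<A> = {X \<in> Obj C. ObjMap F X \<in> \<A>}"


section \<open>Double factorization systems\<close>

locale double_factorization_system = category C
  for C :: "('o, 'm) category" (structure) and \<E> \<J> \<M> :: "'m set" +
  assumes \<E>_subset: "\<E> \<subseteq> Arr C"
    and \<J>_subset: "\<J> \<subseteq> Arr C"
    and \<M>_subset: "\<M> \<subseteq> Arr C"
    and iso_\<E>: "class_comp C (isos C) \<E> \<subseteq> \<E>"
    and iso_\<J>_iso: "class_comp C (isos C) (class_comp C \<J> (isos C)) \<subseteq> \<J>"
    and \<M>_iso: "class_comp C \<M> (isos C) \<subseteq> \<M>"
    and factorization: "Arr C \<subseteq> class_comp C \<M> (class_comp C \<J> \<E>)"
    and diagonal:
      "\<lbrakk>e \<in> \<E>; e \<in> hom C X1 X2; j \<in> \<J>; j \<in> hom C X2 X3;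
        j' \<in> \<J>; j' \<in> hom C Y1 Y2; m \<in> \<M>; m \<in> hom C Y2 Y3;
        u \<in> hom C X1 Y1; v \<in> hom C X3 Y3; v \<cdot> (j \<cdot> e) = m \<cdot> (j' \<cdot> u)\<rbrakk>
       \<Longrightarrow> \<exists>!(s, t). s \<in> hom C X2 Y1 \<and> t \<in> hom C X3 Y2 \<and>
             s \<cdot> e = u \<and> j' \<cdot> s = t \<cdot> j \<and> m \<cdot> t = v"

text \<open>
  \<^term>\<open>(\<E>', \<J>', \<M>')\<close> is the double factorization system on \<^term>\<open>C\<close> that is left-induced,
  along the left adjoint \<^term>\<open>F\<close>, from \<^term>\<open>(\<E>, \<J>, \<M>)\<close> on \<^term>\<open>D\<close>.
\<close>

definition left_induced_dfs ::
  "('o1, 'm1) category \<Rightarrow> ('o2, 'm2) category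
     \<Rightarrow> ('o1, 'm1, 'o2, 'm2) funct \<Rightarrow> ('o2, 'm2, 'o1, 'm1) funct
     \<Rightarrow> ('o1 \<Rightarrow> 'm1) \<Rightarrow> ('o2 \<Rightarrow> 'm2)
     \<Rightarrow> 'm2 set \<Rightarrow> 'm2 set \<Rightarrow> 'm2 set \<Rightarrow> 'm1 set \<Rightarrow> 'm1 set \<Rightarrow> 'm1 set \<Rightarrow> bool" where
  "left_induced_dfs C D F H \<eta> \<kappa> \<E> \<J> \<M> \<E>' \<J>' \<M>' \<longleftrightarrow>
     adjunction C D F H \<eta> \<kappa> \<and>
     double_factorization_system D \<E> \<J> \<M> \<and>
     \<E>' = arr_preimage C F \<E> \<and>
     \<J>' = arr_preimage C F \<J> \<and>
     \<M>' = right_perp C (arr_preimage C F (class_comp D \<J> \<E>)) \<and>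
     double_factorization_system C \<E>' \<J>' \<M>'"

locale quillen_adjunction =
  left_dfs: double_factorization_system C \<E>\<^sub>C \<J>\<^sub>C \<M>\<^sub>C +
  right_dfs: double_factorization_system D \<E>\<^sub>D \<J>\<^sub>D \<M>\<^sub>D +
  adjunction C D F H \<eta> \<kappa>
  for C :: "('o1, 'm1) category" and \<E>\<^sub>C \<J>\<^sub>C \<M>\<^sub>C :: "'m1 set"
    and D :: "('o2, 'm2) category" and \<E>\<^sub>D \<J>\<^sub>D \<M>\<^sub>D :: "'m2 set"
    and F :: "('o1, 'm1, 'o2, 'm2) funct" and H :: "('o2, 'm2, 'o1, 'm1) funct"
    and \<eta> :: "'o1 \<Rightarrow> 'm1" and \<kappa> :: "'o2 \<Rightarrow> 'm2" +
  assumes preserves_\<J>\<E>: "ArrMap F ` class_comp C \<J>\<^sub>C \<E>\<^sub>C \<subseteq> class_comp D \<J>\<^sub>D \<E>\<^sub>D"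
    and preserves_\<E>: "ArrMap F ` \<E>\<^sub>C \<subseteq> \<E>\<^sub>D"


section \<open>Comonads and their coalgebras\<close>

locale comonad =
  endo: is_functor C C G +
  counit: nat_trans C C G id_functor \<epsilon> +
  comult: nat_trans C C G "comp_functor G G" \<delta>
  for C :: "('o, 'm) category" and G :: "('o, 'm, 'o, 'm) funct"
    and \<epsilon> \<delta> :: "'o \<Rightarrow> 'm" +
  assumes counit_left: "A \<in> Obj C
      \<Longrightarrow> \<epsilon> (ObjMap G A) \<cdot>\<^bsub>C\<^esub> \<delta> A = Ident C (ObjMap G A)"
    and counit_right: "A \<in> Obj C
      \<Longrightarrow> ArrMap G (\<epsilon> A) \<cdot>\<^bsub>C\<^esub> \<delta> A = Ident C (ObjMap G A)"
    and coassoc: "A \<in> Obj C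
      \<Longrightarrow> \<delta> (ObjMap G A) \<cdot>\<^bsub>C\<^esub> \<delta> A = ArrMap G (\<delta> A) \<cdot>\<^bsub>C\<^esub> \<delta> A"

definition coalgebras ::
  "('o, 'm) category \<Rightarrow> ('o, 'm, 'o, 'm) funct \<Rightarrow> ('o \<Rightarrow> 'm) \<Rightarrow> ('o \<Rightarrow> 'm) \<Rightarrow> ('o \<times> 'm) set" where
  "coalgebras C G \<epsilon> \<delta> = {(A, s). A \<in> Obj C \<and> s \<in> hom C A (ObjMap G A) \<and>
     \<epsilon> A \<cdot>\<^bsub>C\<^esub> s = Ident C A \<and> \<delta> A \<cdot>\<^bsub>C\<^esub> s = ArrMap G s \<cdot>\<^bsub>C\<^esub> s}"

text \<open>
  An arrow of the Eilenberg--Moore category carries its domain and codomain, since the same arrow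
  of \<^term>\<open>C\<close> can underlie morphisms between different coalgebras.
\<close>

definition coalgebra_category ::
  "('o, 'm) category \<Rightarrow> ('o, 'm, 'o, 'm) funct \<Rightarrow> ('o \<Rightarrow> 'm) \<Rightarrow> ('o \<Rightarrow> 'm)
     \<Rightarrow> ('o \<times> 'm, ('o \<times> 'm) \<times> 'm \<times> ('o \<times> 'm)) category" where
  "coalgebra_category C G \<epsilon> \<delta> =
     \<lparr>Obj = coalgebras C G \<epsilon> \<delta>,
      Arr = {((A, s), f, (B, t)). (A, s) \<in> coalgebras C G \<epsilon> \<delta> \<and> (B, t) \<in> coalgebras C G \<epsilon> \<delta> \<and>
               f \<in> hom C A B \<and> t \<cdot>\<^bsub>C\<^esub> f = ArrMap G f \<cdot>\<^bsub>C\<^esub> s},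
      Dom = (\<lambda>(X, f, Y). X),
      Cod = (\<lambda>(X, f, Y). Y),
      Ident = (\<lambda>X. (X, Ident C (fst X), X)),
      Comp = (\<lambda>(Y, g, Z) (X, f, Y'). (X, g \<cdot>\<^bsub>C\<^esub> f, Z))\<rparr>"

definition forgetful_functor ::
  "('o \<times> 'm, ('o \<times> 'm) \<times> 'm \<times> ('o \<times> 'm), 'o, 'm) funct" where
  "forgetful_functor = \<lparr>ObjMap = fst, ArrMap = (\<lambda>(X, f, Y). f)\<rparr>"

definition cofree_functor ::
  "('o, 'm) category \<Rightarrow> ('o, 'm, 'o, 'm) funct \<Rightarrow> ('o \<Rightarrow> 'm)
     \<Rightarrow> ('o, 'm, 'o \<times> 'm, ('o \<times> 'm) \<times> 'm \<times> ('o \<times> 'm)) funct" where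
  "cofree_functor C G \<delta> =
     \<lparr>ObjMap = (\<lambda>A. (ObjMap G A, \<delta> A)),
      ArrMap = (\<lambda>f. ((ObjMap G (Dom C f), \<delta> (Dom C f)), ArrMap G f,
                     (ObjMap G (Cod C f), \<delta> (Cod C f))))\<rparr>"

text \<open>The unit at a coalgebra is its structure map, as a morphism to the cofree coalgebra; the
  counit of the adjunction is that of the comonad.\<close>

definition cofree_unit ::
  "('o, 'm, 'o, 'm) funct \<Rightarrow> ('o \<Rightarrow> 'm) \<Rightarrow> 'o \<times> 'm \<Rightarrow> ('o \<times> 'm) \<times> 'm \<times> ('o \<times> 'm)" where
  "cofree_unit G \<delta> = (\<lambda>(A, s). ((A, s), s, (ObjMap G A, \<delta> A)))"

end

theory Submission
  imports Defs
begin

text \<open>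
  In any double factorization system $\mathcal{M} = (\mathcal{J}\cdot\mathcal{E})^\perp$. Given a coalgebra
  morphism $f \colon (A, a) \to (B, b)$ and a factorization $f = mje$ in $\mathcal{C}$, the square with
  left side $je$ and right side $Gm\,Gj$, whose horizontal sides are $Ge\,a$ and $b\,m$, has a unique
  pair of fillers; these are the structure maps that make $e$, $j$, $m$ morphisms of coalgebras, and
  the coalgebra laws follow from uniqueness of fillers.

  If $T$ is terminal, $X$ is $\mathcal{J}\cdot\mathcal{E}$-local iff $X \to T$ lies in $\mathcal{M}$. Since
  $G$ preserves $T$ and $\mathcal{M}$, it preserves local objects; and since the terminal coalgebra lies
  over $GT$, a coalgebra is local iff its underlying object is.
\<close>


section \<open>Composition and functors in terms of domains and codomains\<close>

context category
begin

lemma Arr_hom: "f \<in> Arr C \<Longrightarrow> f \<in> hom C (Dom C f) (Cod C f)"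
  by (simp add: hom_def)

text \<open>The hom-set form of the category axioms mentions objects that do not occur in the
  conclusion. Stating the side conditions as equations between domains and codomains makes them
  usable as conditional rewrite rules.\<close>

lemma Comp_Arr [simp]:
  assumes "f \<in> Arr C" "g \<in> Arr C" "Dom C g = Cod C f"
  shows "g \<cdot> f \<in> Arr C" "Dom C (g \<cdot> f) = Dom C f" "Cod C (g \<cdot> f) = Cod C g"
  using Comp_in_hom[of f "Dom C f" "Cod C f" g "Cod C g"] assms by (auto simp: hom_def)

lemma Ident_Arr [simp]:
  assumes "A \<in> Obj C"
  shows "Ident C A \<in> Arr C" "Dom C (Ident C A) = A" "Cod C (Ident C A) = A"
  using Ident_in_hom[OF assms] by (auto simp: hom_def)

lemma Comp_Ident_Arr [simp]: "f \<in> Arr C \<Longrightarrow> Dom C f = A \<Longrightarrow> f \<cdot> Ident C A = f"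
  using Comp_Ident by (auto simp: hom_def)

lemma Ident_Comp_Arr [simp]: "f \<in> Arr C \<Longrightarrow> Cod C f = A \<Longrightarrow> Ident C A \<cdot> f = f"
  using Ident_Comp by (auto simp: hom_def)

lemma Comp_assoc_Arr [simp]:
  assumes "f \<in> Arr C" "g \<in> Arr C" "h \<in> Arr C" "Dom C g = Cod C f" "Dom C h = Cod C g"
  shows "(h \<cdot> g) \<cdot> f = h \<cdot> (g \<cdot> f)"
  using Comp_assoc[of f "Dom C f" "Cod C f" g "Cod C g" h "Cod C h"] assms
  by (simp add: hom_def)

text \<open>Once composites are bracketed to the right, \<open>p \<cdot> q\<close> no longer occurs
  in \<open>p \<cdot> (q \<cdot> z)\<close>. This is the form in which a commuting square can be
  used in the middle of a longer composite.\<close>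

lemma Comp_reassoc:
  assumes "p \<cdot> q = r \<cdot> s"
    and "p \<in> Arr C" "q \<in> Arr C" "Dom C p = Cod C q" "r \<in> Arr C" "s \<in> Arr C" "Dom C r = Cod C s"
    and "z \<in> Arr C" "Dom C q = Cod C z" "Dom C s = Cod C z"
  shows "p \<cdot> (q \<cdot> z) = r \<cdot> (s \<cdot> z)"
  using assms by (metis Comp_assoc_Arr)

lemma hom_Obj: "f \<in> hom C A B \<Longrightarrow> A \<in> Obj C \<and> B \<in> Obj C"
  using Dom_in_Obj Cod_in_Obj by (auto simp: hom_def)

lemma isosI:
  assumes "f \<in> hom C A B" "g \<in> hom C B A" "g \<cdot> f = Ident C A" "f \<cdot> g = Ident C B"
  shows "f \<in> isos C"
  using assms unfolding isos_def hom_def by auto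

lemma class_compI:
  assumes "a \<in> \<A>" "b \<in> \<B>" "a \<in> hom C X Y" "b \<in> hom C Y Z"
  shows "b \<cdot> a \<in> class_comp C \<B> \<A>"
  using assms unfolding class_comp_def hom_def by fastforce

end

lemma class_compE:
  assumes "f \<in> class_comp C \<B> \<A>" "\<A> \<subseteq> Arr C" "\<B> \<subseteq> Arr C"
  obtains a b where "f = b \<cdot>\<^bsub>C\<^esub> a" "a \<in> \<A>" "b \<in> \<B>"
    "a \<in> hom C (Dom C a) (Dom C b)" "b \<in> hom C (Dom C b) (Cod C b)"
  using assms unfolding class_comp_def hom_def by auto

lemma (in category) class_comp_subset_Arr:
  "\<A> \<subseteq> Arr C \<Longrightarrow> \<B> \<subseteq> Arr C \<Longrightarrow> class_comp C \<B> \<A> \<subseteq> Arr C"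
  by (auto simp: class_comp_def subset_iff)

lemma class_comp_mono:
  "\<A> \<subseteq> \<A>' \<Longrightarrow> \<B> \<subseteq> \<B>' \<Longrightarrow> class_comp C \<B> \<A> \<subseteq> class_comp C \<B>' \<A>'"
  unfolding class_comp_def by blast

context is_functor
begin

lemma ArrMap_Arr [simp]:
  assumes "f \<in> Arr C"
  shows "ArrMap F f \<in> Arr D" "Dom D (ArrMap F f) = ObjMap F (Dom C f)"
    "Cod D (ArrMap F f) = ObjMap F (Cod C f)"
  using ArrMap_in_hom[OF src.Arr_hom[OF assms]] by (auto simp: hom_def)

lemma ArrMap_Comp_Arr [simp]:
  assumes "f \<in> Arr C" "g \<in> Arr C" "Dom C g = Cod C f"
  shows "ArrMap F (g \<cdot>\<^bsub>C\<^esub> f) = ArrMap F g \<cdot>\<^bsub>D\<^esub> ArrMap F f"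
  using ArrMap_Comp[of f "Dom C f" "Cod C f" g "Cod C g"] assms by (simp add: hom_def)

lemma isos_image: "ArrMap F ` isos C \<subseteq> isos D"
proof
  fix h assume "h \<in> ArrMap F ` isos C"
  then obtain f g where h: "h = ArrMap F f" and f: "f \<in> Arr C"
    and g: "g \<in> hom C (Cod C f) (Dom C f)"
    and inv: "g \<cdot>\<^bsub>C\<^esub> f = Ident C (Dom C f)" "f \<cdot>\<^bsub>C\<^esub> g = Ident C (Cod C f)"
    unfolding isos_def by blast
  have g': "g \<in> Arr C" "Dom C g = Cod C f" "Cod C g = Dom C f"
    using g by (auto simp: hom_def)
  have "ArrMap F g \<cdot>\<^bsub>D\<^esub> ArrMap F f = Ident D (ObjMap F (Dom C f))"
    using ArrMap_Comp_Arr[of f g] f g' inv by (simp add: ArrMap_Ident src.Dom_in_Obj)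
  moreover have "ArrMap F f \<cdot>\<^bsub>D\<^esub> ArrMap F g = Ident D (ObjMap F (Cod C f))"
    using ArrMap_Comp_Arr[of g f] f g' inv by (simp add: ArrMap_Ident src.Cod_in_Obj)
  ultimately show "h \<in> isos D"
    using f g' unfolding h by (intro tgt.isosI[of _ _ _ "ArrMap F g"]) (auto simp: hom_def)
qed

lemma class_comp_image:
  assumes "\<A> \<subseteq> Arr C" "\<B> \<subseteq> Arr C"
  shows "ArrMap F ` class_comp C \<B> \<A> \<subseteq> class_comp D (ArrMap F ` \<B>) (ArrMap F ` \<A>)"
proof
  fix h assume "h \<in> ArrMap F ` class_comp C \<B> \<A>"
  then obtain a b where h: "h = ArrMap F (b \<cdot>\<^bsub>C\<^esub> a)" and ab: "a \<in> \<A>" "b \<in> \<B>" "Cod C a = Dom C b"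
    unfolding class_comp_def by blast
  have "a \<in> Arr C" "b \<in> Arr C" using ab assms by auto
  then show "h \<in> class_comp D (ArrMap F ` \<B>) (ArrMap F ` \<A>)"
    unfolding class_comp_def h using ab by fastforce
qed

lemma arr_preimage_image: "ArrMap F ` arr_preimage C F \<A> \<subseteq> \<A>"
  unfolding arr_preimage_def by auto

text \<open>A functor sends composites to composites. For the opposite inclusion a factorization in
  \<open>D\<close> has to be lifted along \<open>F\<close>; for the forgetful functor this is done
  in \<open>arr_preimage_class_comp\<close>.\<close>

lemma class_comp_arr_preimage:
  "class_comp C (arr_preimage C F \<B>) (arr_preimage C F \<A>) \<subseteq> arr_preimage C F (class_comp D \<B> \<A>)"
  (is "?L \<subseteq> _")
proof
  fix f assume f: "f \<in> ?L"
  have sub: "arr_preimage C F \<X> \<subseteq> Arr C" for \<X> unfolding arr_preimage_def by auto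
  have "ArrMap F f \<in> class_comp D \<B> \<A>"
    using class_comp_image[OF sub sub] f
      class_comp_mono[OF arr_preimage_image arr_preimage_image] by blast
  then show "f \<in> arr_preimage C F (class_comp D \<B> \<A>)"
    using f src.class_comp_subset_Arr[OF sub sub] unfolding arr_preimage_def by blast
qed

end


section \<open>Identity functors and composites of functors\<close>

lemma (in category) is_functor_id: "is_functor C C id_functor"
  by unfold_locales (simp_all add: id_functor_def)

lemma is_functor_comp:
  assumes "is_functor C D F" "is_functor D E H"
  shows "is_functor C E (comp_functor H F)"
proof -
  interpret F: is_functor C D F by fact
  interpret H: is_functor D E H by fact
  show ?thesis
    by unfold_locales
      (auto simp: comp_functor_def F.ObjMap_in_Obj H.ObjMap_in_Obj F.ArrMap_Ident H.ArrMap_Ident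
        hom_def)
qed


section \<open>Terminal objects and local objects\<close>

definition terminal :: "('o, 'm) category \<Rightarrow> 'o \<Rightarrow> bool" where
  "terminal C T \<longleftrightarrow> T \<in> Obj C \<and> (\<forall>A \<in> Obj C. \<exists>!f. f \<in> hom C A T)"

lemma terminal_unique:
  "terminal C T \<Longrightarrow> A \<in> Obj C \<Longrightarrow> f \<in> hom C A T \<Longrightarrow> g \<in> hom C A T \<Longrightarrow> f = g"
  unfolding terminal_def by blast

text \<open>Index category whose limits are terminal objects. Its type is left general so that it
  can serve both as a small and as a finite index category.\<close>

definition empty_cat :: "('i, 'j) category" where
  "empty_cat = \<lparr>Obj = {}, Arr = {}, Dom = (\<lambda>_. undefined), Cod = (\<lambda>_. undefined),
     Ident = (\<lambda>_. undefined), Comp = (\<lambda>_ _. undefined)\<rparr>"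

lemma category_empty_cat: "category empty_cat"
  by standard (simp_all add: empty_cat_def hom_def)

lemma is_limit_empty_cat: "is_limit empty_cat C D L p \<longleftrightarrow> terminal C L"
  by (auto simp: is_limit_def is_cone_def terminal_def empty_cat_def)

lemma (in category) is_functor_empty_cat: "is_functor empty_cat C D"
  by (intro is_functor.intro category_empty_cat category_axioms is_functor_axioms.intro)
    (simp_all add: empty_cat_def hom_def)

text \<open>The cardinality is strictly smaller because a type is never empty, so the empty set has
  no bijection onto it.\<close>

lemma small_cat_empty_cat: "small_cat (empty_cat :: ('u, 'u) category)"
  unfolding small_cat_def lesspoll_def
  by (simp add: category_empty_cat) (simp add: empty_cat_def eqpoll_def bij_betw_def)

lemma finite_cat_empty_cat: "finite_cat empty_cat"
  unfolding finite_cat_def by (simp add: category_empty_cat) (simp add: empty_cat_def)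

text \<open>The empty diagram is both small and finite, so either alternative of the hypothesis
  yields a terminal object and its preservation.\<close>

lemma preserved_terminal_objects:
  assumes "(bicomplete TYPE('u) C \<and> preserves_small_limits TYPE('u) C C G) \<or>
    (finitely_bicomplete C \<and> preserves_finite_limits C C G)"
  shows "\<exists>T. terminal C T" "terminal C T \<Longrightarrow> terminal C (ObjMap G T)"
proof -
  have C: "category C"
    using assms unfolding bicomplete_def finitely_bicomplete_def by blast
  note functors = category.is_functor_empty_cat[OF C]
  have "(\<exists>T. terminal C T) \<and> (\<forall>T. terminal C T \<longrightarrow> terminal C (ObjMap G T))"
    using assms
  proof (elim disjE conjE)
    assume "bicomplete TYPE('u) C" "preserves_small_limits TYPE('u) C C G"
    then show ?thesis
      unfolding bicomplete_def preserves_small_limits_def preserves_limits_of_shape_def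
      using small_cat_empty_cat functors is_limit_empty_cat by metis
  next
    assume "finitely_bicomplete C" "preserves_finite_limits C C G"
    then show ?thesis
      unfolding finitely_bicomplete_def preserves_finite_limits_def preserves_limits_of_shape_def
      using finite_cat_empty_cat functors is_limit_empty_cat by metis
  qed
  then show "\<exists>T. terminal C T" "terminal C T \<Longrightarrow> terminal C (ObjMap G T)" by blast+
qed

text \<open>Links the bijections that define local objects with the unique fillers that define
  orthogonality.\<close>

lemma bij_betw_iff_ex1:
  assumes "f ` A \<subseteq> B"
  shows "bij_betw f A B \<longleftrightarrow> (\<forall>y \<in> B. \<exists>!x. x \<in> A \<and> f x = y)"
proof
  assume "bij_betw f A B"
  then show "\<forall>y \<in> B. \<exists>!x. x \<in> A \<and> f x = y"
    by (auto simp: bij_betw_def inj_on_def)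
next
  assume R: "\<forall>y \<in> B. \<exists>!x. x \<in> A \<and> f x = y"
  have "inj_on f A"
  proof (rule inj_onI)
    fix x y assume "x \<in> A" "y \<in> A" "f x = f y"
    moreover from this have "\<exists>!z. z \<in> A \<and> f z = f y" using R assms by blast
    ultimately show "x = y" by blast
  qed
  moreover have "B \<subseteq> f ` A" using R by blast
  ultimately show "bij_betw f A B" using assms by (simp add: bij_betw_def subset_antisym)
qed

text \<open>Two parallel arrows into \<open>T\<close> are equal, so every square from
  \<open>f\<close> to \<open>q\<close> commutes and its lower triangle is automatic. What remains of
  a filler is a unique \<open>d\<close> with \<open>d \<cdot> f = u\<close>.\<close>

lemma (in category) orthogonal_to_terminal_iff:
  assumes T: "terminal C T" and q: "q \<in> hom C X T" and f: "f \<in> Arr C"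
  shows "orthogonal C f q \<longleftrightarrow>
    bij_betw (\<lambda>g. g \<cdot> f) (hom C (Cod C f) X) (hom C (Dom C f) X)"
proof -
  have q': "q \<in> Arr C" "Dom C q = X" "Cod C q = T" using q by (auto simp: hom_def)
  have cod: "Cod C f \<in> Obj C" and dom: "Dom C f \<in> Obj C"
    using f by (simp_all add: Dom_in_Obj Cod_in_Obj)
  \<comment> \<open>The forward direction needs some \<open>v\<close>: orthogonality speaks about
    \<open>u\<close> only when a square containing \<open>u\<close> is given.\<close>
  obtain v where v: "v \<in> hom C (Cod C f) T"
    using T cod unfolding terminal_def by blast
  have eqT: "g = h" if "g \<in> hom C (Cod C f) T" "h \<in> hom C (Cod C f) T" for g h
    using terminal_unique[OF T cod] that by blast
  have eqT': "g = h" if "g \<in> hom C (Dom C f) T" "h \<in> hom C (Dom C f) T" for g h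
    using terminal_unique[OF T dom] that by blast
  have square: "v \<cdot> f = q \<cdot> u" if "u \<in> hom C (Dom C f) X" "v \<in> hom C (Cod C f) T" for u v
    by (rule eqT') (use that f q' in \<open>auto simp: hom_def\<close>)
  have triangle: "q \<cdot> d = v" if "d \<in> hom C (Cod C f) X" "v \<in> hom C (Cod C f) T" for d v
    by (rule eqT) (use that f q' in \<open>auto simp: hom_def\<close>)
  have "orthogonal C f q \<longleftrightarrow>
    (\<forall>u \<in> hom C (Dom C f) X. \<exists>!d. d \<in> hom C (Cod C f) X \<and> d \<cdot> f = u)"
    unfolding orthogonal_def q' using square triangle v by (smt (verit, best))
  also have "\<dots> \<longleftrightarrow> bij_betw (\<lambda>g. g \<cdot> f) (hom C (Cod C f) X) (hom C (Dom C f) X)"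
  proof -
    have into: "(\<lambda>g. g \<cdot> f) ` hom C (Cod C f) X \<subseteq> hom C (Dom C f) X"
      using f by (auto simp: hom_def)
    show ?thesis
      by (simp add: bij_betw_iff_ex1[OF into])
  qed
  finally show ?thesis .
qed


section \<open>Double factorization systems\<close>

lemma unique_eq: "\<exists>!x. P x \<Longrightarrow> P a \<Longrightarrow> P b \<Longrightarrow> a = b"
  by blast

context double_factorization_system
begin

text \<open>Uniqueness in axiom (3) for the square with top \<open>s \<cdot> e\<close> and bottom
  \<open>m \<cdot> t\<close>: both pairs fill it. Equations between arrows are proved below by
  exhibiting their two sides as components of such pairs.\<close>

lemma diagonal_unique:
  assumes e: "e \<in> \<E>" "e \<in> hom C X1 X2" and j: "j \<in> \<J>" "j \<in> hom C X2 X3"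
    and j': "j' \<in> \<J>" "j' \<in> hom C Y1 Y2" and m: "m \<in> \<M>" "m \<in> hom C Y2 Y3"
    and s: "s \<in> hom C X2 Y1" "s' \<in> hom C X2 Y1"
    and t: "t \<in> hom C X3 Y2" "t' \<in> hom C X3 Y2"
    and eq: "s \<cdot> e = s' \<cdot> e" "j' \<cdot> s = t \<cdot> j" "j' \<cdot> s' = t' \<cdot> j" "m \<cdot> t = m \<cdot> t'"
  shows "s = s'" "t = t'"
proof -
  have u: "s \<cdot> e \<in> hom C X1 Y1" and v: "m \<cdot> t \<in> hom C X3 Y3"
    using Comp_in_hom e s t m by blast+
  have "(m \<cdot> t) \<cdot> (j \<cdot> e) = m \<cdot> ((t \<cdot> j) \<cdot> e)"
    using e j m t by (auto simp: hom_def)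
  also have "\<dots> = m \<cdot> (j' \<cdot> (s \<cdot> e))"
    unfolding eq(2)[symmetric] using e j' s by (auto simp: hom_def)
  finally have "\<exists>!(s', t'). s' \<in> hom C X2 Y1 \<and> t' \<in> hom C X3 Y2 \<and>
      s' \<cdot> e = s \<cdot> e \<and> j' \<cdot> s' = t' \<cdot> j \<and> m \<cdot> t' = m \<cdot> t"
    by (rule diagonal[OF e j j' m u v])
  moreover have "case (s, t) of (s', t') \<Rightarrow> s' \<in> hom C X2 Y1 \<and> t' \<in> hom C X3 Y2 \<and>
      s' \<cdot> e = s \<cdot> e \<and> j' \<cdot> s' = t' \<cdot> j \<and> m \<cdot> t' = m \<cdot> t"
    using s t eq by simp
  moreover have "case (s', t') of (s', t') \<Rightarrow> s' \<in> hom C X2 Y1 \<and> t' \<in> hom C X3 Y2 \<and>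
      s' \<cdot> e = s \<cdot> e \<and> j' \<cdot> s' = t' \<cdot> j \<and> m \<cdot> t' = m \<cdot> t"
    using s t eq by simp
  ultimately have "(s, t) = (s', t')" by (rule unique_eq)
  then show "s = s'" "t = t'" by auto
qed

lemma factorE:
  assumes "f \<in> hom C A B"
  obtains e j m X Y where "e \<in> \<E>" "e \<in> hom C A X" "j \<in> \<J>" "j \<in> hom C X Y"
    "m \<in> \<M>" "m \<in> hom C Y B" "f = m \<cdot> (j \<cdot> e)"
proof -
  have "f \<in> class_comp C \<M> (class_comp C \<J> \<E>)"
    using assms factorization by (auto simp: hom_def)
  then obtain e j m where *: "f = m \<cdot> (j \<cdot> e)" "e \<in> \<E>" "j \<in> \<J>" "m \<in> \<M>"
    "Cod C e = Dom C j" "Cod C (j \<cdot> e) = Dom C m"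
    unfolding class_comp_def by blast
  have "e \<in> Arr C" "j \<in> Arr C" "m \<in> Arr C"
    using * \<E>_subset \<J>_subset \<M>_subset by auto
  then show ?thesis using * assms
    by (intro that[of e "Dom C j" j "Cod C j" m]) (auto simp: hom_def)
qed

text \<open>If $1 = mje$, then $(emj, jem)$ and $(1, 1)$ both fill the square with left and right side
  $mje$, so $e$, $j$ and $m$ are invertible.\<close>

lemma Ident_in_classes:
  assumes D: "D \<in> Obj C"
  shows "Ident C D \<in> \<J>" "Ident C D \<in> \<M>"
proof -
  obtain e j m X Y where e: "e \<in> \<E>" "e \<in> hom C D X" and j: "j \<in> \<J>" "j \<in> hom C X Y"
    and m: "m \<in> \<M>" "m \<in> hom C Y D" and eq: "Ident C D = m \<cdot> (j \<cdot> e)"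
    by (rule factorE[OF Ident_in_hom[OF D]])
  have e': "e \<in> Arr C" "Dom C e = D" "Cod C e = X"
    and j': "j \<in> Arr C" "Dom C j = X" "Cod C j = Y"
    and m': "m \<in> Arr C" "Dom C m = Y" "Cod C m = D"
    using e j m by (auto simp: hom_def)
  note typing = e' j' m'
  have X: "X \<in> Obj C" and Y: "Y \<in> Obj C" using hom_Obj e j by blast+
  have eq_r: "m \<cdot> (j \<cdot> (e \<cdot> z)) = z" if "z \<in> Arr C" "Cod C z = D" for z
  proof -
    have "m \<cdot> (j \<cdot> (e \<cdot> z)) = (m \<cdot> (j \<cdot> e)) \<cdot> z" using that typing by simp
    then show ?thesis using that by (simp add: eq[symmetric])
  qed
  have inv: "e \<cdot> (m \<cdot> j) = Ident C X" "j \<cdot> (e \<cdot> m) = Ident C Y"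
    by (rule diagonal_unique[OF e j j m, where s = "e \<cdot> (m \<cdot> j)" and s' = "Ident C X"
          and t = "j \<cdot> (e \<cdot> m)" and t' = "Ident C Y"]; use typing X Y in \<open>simp add: hom_def eq[symmetric] eq_r\<close>)+
  \<comment> \<open>The inverse of \<open>j \<cdot> e\<close> is \<open>m\<close>, so the identity
    is a member of \<open>\<M>\<close> after an isomorphism. With \<open>e\<close> and
    \<open>m\<close> invertible as well, it is also a member of \<open>\<J>\<close> between two
    isomorphisms.\<close>
  have "j \<cdot> e \<in> isos C"
    by (rule isosI[of _ D Y m]) (use typing inv eq in \<open>simp_all add: hom_def\<close>)
  then have "m \<cdot> (j \<cdot> e) \<in> class_comp C \<M> (isos C)"
    by (rule class_compI) (use m typing in \<open>simp_all add: hom_def\<close>)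
  then show "Ident C D \<in> \<M>" using \<M>_iso eq by auto
  have "e \<in> isos C"
    by (rule isosI[of _ D X "m \<cdot> j"]) (use typing inv eq in \<open>simp_all add: hom_def\<close>)
  then have je: "j \<cdot> e \<in> class_comp C \<J> (isos C)"
    by (rule class_compI) (use e j in simp_all)
  have "m \<in> isos C"
    by (rule isosI[of _ Y D "j \<cdot> e"]) (use typing inv eq in \<open>simp_all add: hom_def\<close>)
  then have "m \<cdot> (j \<cdot> e) \<in> class_comp C (isos C) (class_comp C \<J> (isos C))"
    by (rule class_compI[OF je]) (use m typing in \<open>simp_all add: hom_def\<close>)
  then show "Ident C D \<in> \<J>" using iso_\<J>_iso eq by auto
qed

section \<open>Trivial fibrations as a right orthogonal class\<close>

lemma orthogonal_\<M>:
  assumes f: "f \<in> class_comp C \<J> \<E>" and m: "m \<in> \<M>"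
  shows "orthogonal C f m"
proof -
  obtain e j where fje: "f = j \<cdot> e" and e: "e \<in> \<E>" "e \<in> hom C (Dom C e) (Dom C j)"
    and j: "j \<in> \<J>" "j \<in> hom C (Dom C j) (Cod C j)"
    by (rule class_compE[OF f \<E>_subset \<J>_subset])
  have m': "m \<in> hom C (Dom C m) (Cod C m)" using m \<M>_subset Arr_hom by auto
  let ?Y = "Dom C m"
  have Y: "?Y \<in> Obj C" using hom_Obj m' by blast
  have typing: "e \<in> Arr C" "Cod C e = Dom C j" "j \<in> Arr C" "m \<in> Arr C"
    using e j m' by (auto simp: hom_def)
  show ?thesis
    unfolding orthogonal_def
  proof (intro ballI impI)
    fix u v assume u: "u \<in> hom C (Dom C f) ?Y" and v: "v \<in> hom C (Cod C f) (Cod C m)"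
      and eq: "v \<cdot> f = m \<cdot> u"
    have u': "u \<in> hom C (Dom C e) ?Y" and v': "v \<in> hom C (Cod C j) (Cod C m)"
      using u v typing fje by simp_all
    have "v \<cdot> (j \<cdot> e) = m \<cdot> (Ident C ?Y \<cdot> u)"
      using eq u' fje by (simp add: hom_def)
    \<comment> \<open>Axiom (3) is used with \<open>j'\<close> the identity of the domain of
      \<open>m\<close>, which lies in \<open>\<J>\<close>. The middle equation then says
      \<open>s = t \<cdot> j\<close>, so the pair of fillers amounts to the single arrow
      \<open>t\<close>.\<close>
    from diagonal[OF e j Ident_in_classes(1)[OF Y] Ident_in_hom[OF Y] m m' u' v' this]
    obtain s t where st: "s \<in> hom C (Dom C j) ?Y" "t \<in> hom C (Cod C j) ?Y"
      "s \<cdot> e = u" "Ident C ?Y \<cdot> s = t \<cdot> j" "m \<cdot> t = v"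
      by blast
    show "\<exists>!d. d \<in> hom C (Cod C f) ?Y \<and> d \<cdot> f = u \<and> m \<cdot> d = v"
    proof (rule ex1I[of _ t])
      show "t \<in> hom C (Cod C f) ?Y \<and> t \<cdot> f = u \<and> m \<cdot> t = v"
        using st typing fje Comp_assoc_Arr[of e j t] by (auto simp: hom_def)
    next
      fix d assume d: "d \<in> hom C (Cod C f) ?Y \<and> d \<cdot> f = u \<and> m \<cdot> d = v"
      \<comment> \<open>Any filler \<open>d\<close> gives the pair \<open>d \<cdot> j\<close>,
        \<open>d\<close>, to be compared with \<open>s\<close>, \<open>t\<close>.\<close>
      show "d = t"
        by (rule diagonal_unique(2)[OF e j Ident_in_classes(1)[OF Y] Ident_in_hom[OF Y] m m',
              of "d \<cdot> j" s]) (use d st typing fje in \<open>auto simp: hom_def\<close>)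
    qed
  qed
qed

text \<open>For the harder inclusion, factor \<open>g = m \<cdot> (j \<cdot> e)\<close>.
  Orthogonality of \<open>j \<cdot> e\<close> to \<open>g\<close> gives \<open>d\<close> with
  \<open>d \<cdot> (j \<cdot> e) = 1\<close> and \<open>g \<cdot> d = m\<close>. Both
  \<open>(j \<cdot> e) \<cdot> d\<close> and the identity fill the square from
  \<open>j \<cdot> e\<close> to \<open>m\<close> with top \<open>j \<cdot> e\<close> and bottom
  \<open>m\<close>, so \<open>j \<cdot> e\<close> is invertible and \<open>g\<close> lies in
  \<open>\<M>\<close> composed with isomorphisms.\<close>

lemma \<M>_eq_right_perp: "\<M> = right_perp C (class_comp C \<J> \<E>)"
proof
  show "\<M> \<subseteq> right_perp C (class_comp C \<J> \<E>)"
    unfolding right_perp_def using \<M>_subset orthogonal_\<M> by auto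
next
  show "right_perp C (class_comp C \<J> \<E>) \<subseteq> \<M>"
  proof
    fix g assume g: "g \<in> right_perp C (class_comp C \<J> \<E>)"
    then have gA: "g \<in> Arr C" unfolding right_perp_def by simp
    obtain e j m X Y where e: "e \<in> \<E>" "e \<in> hom C (Dom C g) X" and j: "j \<in> \<J>" "j \<in> hom C X Y"
      and m: "m \<in> \<M>" "m \<in> hom C Y (Cod C g)" and eq: "g = m \<cdot> (j \<cdot> e)"
      by (rule factorE[OF Arr_hom[OF gA]])
    let ?f = "j \<cdot> e"
    have f: "?f \<in> class_comp C \<J> \<E>" "?f \<in> hom C (Dom C g) Y"
      using class_compI[OF e(1) j(1) e(2) j(2)] Comp_in_hom e j by auto
    have typing: "?f \<in> Arr C" "Dom C ?f = Dom C g" "Cod C ?f = Y"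
      "m \<in> Arr C" "Dom C m = Y" "Cod C m = Cod C g"
      using f m by (auto simp: hom_def)
    have obj: "Dom C g \<in> Obj C" "Y \<in> Obj C" using hom_Obj f by blast+
    have "orthogonal C ?f g" using g f unfolding right_perp_def by simp
    moreover have "m \<cdot> ?f = g \<cdot> Ident C (Dom C g)" using eq gA by simp
    ultimately obtain d where d: "d \<in> hom C Y (Dom C g)" "d \<cdot> ?f = Ident C (Dom C g)" "g \<cdot> d = m"
      unfolding orthogonal_def typing using m Ident_in_hom[OF obj(1)] by blast
    have d': "d \<in> Arr C" "Dom C d = Y" "Cod C d = Dom C g" using d by (auto simp: hom_def)
    have ex1: "\<exists>!k. k \<in> hom C Y Y \<and> k \<cdot> ?f = ?f \<and> m \<cdot> k = m"
      using orthogonal_\<M>[OF f(1) m(1)] f(2) m(2) unfolding orthogonal_def typing by blast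
    have "?f \<cdot> d = Ident C Y"
    proof (rule unique_eq[OF ex1])
      have "(m \<cdot> ?f) \<cdot> d = m \<cdot> (?f \<cdot> d)"
        by (rule Comp_assoc_Arr) (simp_all only: typing d')
      then have "m \<cdot> (?f \<cdot> d) = m"
        by (simp only: eq[symmetric] d(3))
      moreover have "(?f \<cdot> d) \<cdot> ?f = ?f \<cdot> (d \<cdot> ?f)"
        by (rule Comp_assoc_Arr) (simp_all only: typing d')
      then have "(?f \<cdot> d) \<cdot> ?f = ?f"
        by (simp only: d(2) typing Comp_Ident_Arr)
      moreover have "?f \<cdot> d \<in> hom C Y Y"
        using Comp_in_hom d(1) f(2) by blast
      ultimately show "?f \<cdot> d \<in> hom C Y Y \<and> (?f \<cdot> d) \<cdot> ?f = ?f \<and> m \<cdot> (?f \<cdot> d) = m" by blast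
    next
      show "Ident C Y \<in> hom C Y Y \<and> Ident C Y \<cdot> ?f = ?f \<and> m \<cdot> Ident C Y = m"
        using Ident_in_hom[OF obj(2)] Ident_Comp[OF f(2)] Comp_Ident[OF m(2)] by blast
    qed
    then have "?f \<in> isos C" by (rule isosI[OF f(2) d(1) d(2)])
    then have "m \<cdot> ?f \<in> class_comp C \<M> (isos C)"
      by (rule class_compI[OF _ m(1) f(2) m(2)])
    then show "g \<in> \<M>" using \<M>_iso eq by auto
  qed
qed

text \<open>By \<open>orthogonal_to_terminal_iff\<close>, locality of \<open>X\<close> is
  orthogonality of the class to \<open>q\<close>, and \<open>\<M>_eq_right_perp\<close> identifies
  this with membership in \<open>\<M>\<close>.\<close>

lemma local_objects_iff:
  assumes T: "terminal C T" and q: "q \<in> hom C X T"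
  shows "X \<in> local_objects C (class_comp C \<J> \<E>) \<longleftrightarrow> q \<in> \<M>"
proof -
  have "X \<in> Obj C" "q \<in> Arr C" using hom_Obj[OF q] q by (auto simp: hom_def)
  then show ?thesis
    unfolding \<M>_eq_right_perp local_objects_def right_perp_def
    using orthogonal_to_terminal_iff[OF T q] class_comp_subset_Arr[OF \<E>_subset \<J>_subset] by blast
qed

end


section \<open>The cofree coalgebra adjunction\<close>

context comonad
begin

section \<open>The category of coalgebras and the forgetful functor\<close>

abbreviation "EM \<equiv> coalgebra_category C G \<epsilon> \<delta>"

abbreviation "U \<equiv> forgetful_functor :: ('o \<times> 'm, ('o \<times> 'm) \<times> 'm \<times> 'o \<times> 'm, 'o, 'm) funct"

lemma coalgebras_iff: "(A, s) \<in> coalgebras C G \<epsilon> \<delta> \<longleftrightarrow> A \<in> Obj C \<and>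
    s \<in> Arr C \<and> Dom C s = A \<and> Cod C s = ObjMap G A \<and>
    \<epsilon> A \<cdot>\<^bsub>C\<^esub> s = Ident C A \<and> \<delta> A \<cdot>\<^bsub>C\<^esub> s = ArrMap G s \<cdot>\<^bsub>C\<^esub> s"
  by (auto simp: coalgebras_def hom_def)

lemma Arr_EM_iff: "(X, f, Y) \<in> Arr EM \<longleftrightarrow>
    X \<in> coalgebras C G \<epsilon> \<delta> \<and> Y \<in> coalgebras C G \<epsilon> \<delta> \<and>
    f \<in> Arr C \<and> Dom C f = fst X \<and> Cod C f = fst Y \<and> snd Y \<cdot>\<^bsub>C\<^esub> f = ArrMap G f \<cdot>\<^bsub>C\<^esub> snd X"
  by (cases X; cases Y) (auto simp: coalgebra_category_def hom_def)

lemma EM_simps [simp]: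
  "Obj EM = coalgebras C G \<epsilon> \<delta>" "Dom EM (X, f, Y) = X" "Cod EM (X, f, Y) = Y"
  "Ident EM X = (X, Ident C (fst X), X)" "(Y', g, Z) \<cdot>\<^bsub>EM\<^esub> (X, f, Y) = (X, g \<cdot>\<^bsub>C\<^esub> f, Z)"
  by (auto simp: coalgebra_category_def)

lemma hom_EM_iff: "\<phi> \<in> hom EM X Y \<longleftrightarrow> (\<exists>f. \<phi> = (X, f, Y) \<and> (X, f, Y) \<in> Arr EM)"
  by (cases \<phi>) (auto simp: hom_def)

lemma U_simps [simp]: "ObjMap U X = fst X" "ArrMap U (X, f, Y) = f"
  by (simp_all add: forgetful_functor_def)

lemma counit_simps [simp]:
  assumes "A \<in> Obj C"
  shows "\<epsilon> A \<in> Arr C" "Dom C (\<epsilon> A) = ObjMap G A" "Cod C (\<epsilon> A) = A"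
  using counit.component_in_hom[OF assms] by (auto simp: hom_def id_functor_def)

lemma comult_simps [simp]:
  assumes "A \<in> Obj C"
  shows "\<delta> A \<in> Arr C" "Dom C (\<delta> A) = ObjMap G A" "Cod C (\<delta> A) = ObjMap G (ObjMap G A)"
  using comult.component_in_hom[OF assms] by (auto simp: hom_def comp_functor_def)

lemma counit_natural: "f \<in> Arr C \<Longrightarrow> \<epsilon> (Cod C f) \<cdot>\<^bsub>C\<^esub> ArrMap G f = f \<cdot>\<^bsub>C\<^esub> \<epsilon> (Dom C f)"
  using counit.naturality[OF endo.src.Arr_hom, of f] by (simp add: id_functor_def)

lemma comult_natural:
  "f \<in> Arr C \<Longrightarrow> \<delta> (Cod C f) \<cdot>\<^bsub>C\<^esub> ArrMap G f = ArrMap G (ArrMap G f) \<cdot>\<^bsub>C\<^esub> \<delta> (Dom C f)"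
  using comult.naturality[OF endo.src.Arr_hom, of f] by (simp add: comp_functor_def)

lemmas obj_simps [simp] = endo.ObjMap_in_Obj endo.src.Dom_in_Obj endo.src.Cod_in_Obj

text \<open>The two coalgebra laws for \<open>\<delta> A\<close> are the comonad laws
  \<open>counit_left\<close> and \<open>coassoc\<close>.\<close>

lemma cofree_in_coalgebras: "A \<in> Obj C \<Longrightarrow> (ObjMap G A, \<delta> A) \<in> coalgebras C G \<epsilon> \<delta>"
  by (simp add: coalgebras_iff counit_left coassoc)

lemma category_EM: "category EM"
proof
  show "Dom EM f \<in> Obj EM" "Cod EM f \<in> Obj EM" if "f \<in> Arr EM" for f
    using that by (cases f; simp add: Arr_EM_iff)+
next
  show "Ident EM X \<in> hom EM X X" if "X \<in> Obj EM" for X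
    using that by (cases X) (simp add: hom_EM_iff Arr_EM_iff coalgebras_iff endo.ArrMap_Ident)
next
  fix f g :: "('o \<times> 'm) \<times> 'm \<times> 'o \<times> 'm" and X Y Z
  assume "f \<in> hom EM X Y" "g \<in> hom EM Y Z"
  then show "g \<cdot>\<^bsub>EM\<^esub> f \<in> hom EM X Z"
    by (cases X; cases Y; cases Z, clarsimp simp: hom_EM_iff Arr_EM_iff coalgebras_iff)
      (metis endo.src.Comp_assoc_Arr endo.ArrMap_Arr)
next
  show "f \<cdot>\<^bsub>EM\<^esub> Ident EM X = f" "Ident EM Y \<cdot>\<^bsub>EM\<^esub> f = f" if "f \<in> hom EM X Y" for f X Y
    using that by (auto simp: hom_EM_iff Arr_EM_iff)
next
  show "h \<cdot>\<^bsub>EM\<^esub> g \<cdot>\<^bsub>EM\<^esub> f = h \<cdot>\<^bsub>EM\<^esub> (g \<cdot>\<^bsub>EM\<^esub> f)"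
    if "f \<in> hom EM X Y" "g \<in> hom EM Y Z" "h \<in> hom EM Z W" for f g h X Y Z W
    using that by (auto simp: hom_EM_iff Arr_EM_iff)
qed

sublocale EM: category EM
  by (rule category_EM)

sublocale U: is_functor EM C U
proof
  show "ObjMap U X \<in> Obj C" if "X \<in> Obj EM" for X
    using that by (cases X) (simp add: coalgebras_iff)
qed (auto simp: hom_EM_iff Arr_EM_iff hom_def)

section \<open>The cofree functor and its adjunction\<close>

abbreviation "R \<equiv> cofree_functor C G \<delta>"

lemma R_simps [simp]: "ObjMap R A = (ObjMap G A, \<delta> A)"
  "ArrMap R f = ((ObjMap G (Dom C f), \<delta> (Dom C f)), ArrMap G f, (ObjMap G (Cod C f), \<delta> (Cod C f)))"
  by (simp_all add: cofree_functor_def)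

sublocale R: is_functor C EM R
proof
  show "ObjMap R A \<in> Obj EM" if "A \<in> Obj C" for A
    using that by (simp add: cofree_in_coalgebras)
  \<comment> \<open>Naturality of \<open>\<delta>\<close> is the condition for \<open>G f\<close> to
    be a morphism of cofree coalgebras.\<close>
  show "ArrMap R f \<in> hom EM (ObjMap R A) (ObjMap R B)" if "f \<in> hom C A B" for f A B
    using that by (auto simp: hom_def hom_EM_iff Arr_EM_iff cofree_in_coalgebras comult_natural)
  show "ArrMap R (Ident C A) = Ident EM (ObjMap R A)" if "A \<in> Obj C" for A
    using that by (simp add: endo.ArrMap_Ident)
  show "ArrMap R (g \<cdot>\<^bsub>C\<^esub> f) = ArrMap R g \<cdot>\<^bsub>EM\<^esub> ArrMap R f"
    if "f \<in> hom C A B" "g \<in> hom C B D" for f g A B D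
    using that by (auto simp: hom_def)
qed

text \<open>The unit at a coalgebra is a coalgebra morphism by coassociativity of the structure map,
  and its naturality is the defining equation of coalgebra morphisms. The triangle identities are
  the counit law of a coalgebra and \<open>counit_right\<close>.\<close>

lemma adjunction_cofree: "adjunction EM C U R (cofree_unit G \<delta>) \<epsilon>"
proof (intro adjunction.intro nat_trans.intro nat_trans_axioms.intro adjunction_axioms.intro
    U.is_functor_axioms R.is_functor_axioms EM.is_functor_id endo.src.is_functor_id
    is_functor_comp[where D = C and E = EM] is_functor_comp[where D = EM and E = C])
  show "cofree_unit G \<delta> X \<in> hom EM (ObjMap id_functor X) (ObjMap (comp_functor R U) X)"
    if "X \<in> Obj EM" for X
    using that by (cases X) (auto simp: cofree_unit_def hom_EM_iff Arr_EM_iff id_functor_def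
      comp_functor_def coalgebras_iff cofree_in_coalgebras counit_left coassoc)
  show "cofree_unit G \<delta> Y \<cdot>\<^bsub>EM\<^esub> ArrMap id_functor f
      = ArrMap (comp_functor R U) f \<cdot>\<^bsub>EM\<^esub> cofree_unit G \<delta> X" if "f \<in> hom EM X Y" for f X Y
    using that by (cases X; cases Y) (auto simp: cofree_unit_def hom_EM_iff Arr_EM_iff id_functor_def
      comp_functor_def)
  show "\<epsilon> A \<in> hom C (ObjMap (comp_functor U R) A) (ObjMap id_functor A)" if "A \<in> Obj C" for A
    using that by (simp add: hom_def comp_functor_def id_functor_def)
  show "\<epsilon> B \<cdot>\<^bsub>C\<^esub> ArrMap (comp_functor U R) f = ArrMap id_functor f \<cdot>\<^bsub>C\<^esub> \<epsilon> A"
    if "f \<in> hom C A B" for f A B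
    using that counit_natural by (auto simp: hom_def comp_functor_def id_functor_def)
  show "\<epsilon> (ObjMap U X) \<cdot>\<^bsub>C\<^esub> ArrMap U (cofree_unit G \<delta> X) = Ident C (ObjMap U X)"
    if "X \<in> Obj EM" for X
    using that by (cases X) (simp add: cofree_unit_def coalgebras_iff)
  show "ArrMap R (\<epsilon> A) \<cdot>\<^bsub>EM\<^esub> cofree_unit G \<delta> (ObjMap R A) = Ident EM (ObjMap R A)"
    if "A \<in> Obj C" for A
    using that by (simp add: cofree_unit_def counit_right)
qed

end


section \<open>Lifting to coalgebras\<close>

text \<open>With \<open>G j\<close> in \<open>\<J>\<close> and \<open>G m\<close> in
  \<open>\<M>\<close>, axiom (3) applies to squares whose right side is the image under
  \<open>G\<close> of a composite \<open>m \<cdot> j\<close>.\<close>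

locale dfs_comonad = double_factorization_system C \<E> \<J> \<M> + comonad C G \<epsilon> \<delta>
  for C :: "('o, 'm) category" and G :: "('o, 'm, 'o, 'm) funct" and \<epsilon> \<delta> :: "'o \<Rightarrow> 'm"
    and \<E> \<J> \<M> :: "'m set" +
  assumes G_\<M>: "ArrMap G ` \<M> \<subseteq> \<M>" and G_\<J>: "ArrMap G ` \<J> \<subseteq> \<J>"
begin

text \<open>The pairs \<open>b \<cdot> s\<close>, \<open>d \<cdot> t\<close> and
  \<open>G s \<cdot> x\<close>, \<open>G t \<cdot> y\<close> fill the same square with left side
  \<open>e\<close>, \<open>j\<close> and right side \<open>G j'\<close>, \<open>G m\<close>. Their
  equality says that \<open>s\<close> and \<open>t\<close> are coalgebra morphisms.\<close>

lemma lift_diagonal: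
  assumes AX: "((A, a), e, (X, x)) \<in> Arr EM" "e \<in> \<E>"
    and XY: "((X, x), j, (Y, y)) \<in> Arr EM" "j \<in> \<J>"
    and BD: "((B, b), j', (D, d)) \<in> Arr EM" "j' \<in> \<J>"
    and DF: "((D, d), m, (F, f)) \<in> Arr EM" "m \<in> \<M>"
    and u: "((A, a), s \<cdot>\<^bsub>C\<^esub> e, (B, b)) \<in> Arr EM"
    and v: "((Y, y), m \<cdot>\<^bsub>C\<^esub> t, (F, f)) \<in> Arr EM"
    and s: "s \<in> hom C X B" and t: "t \<in> hom C Y D" and eq: "j' \<cdot>\<^bsub>C\<^esub> s = t \<cdot>\<^bsub>C\<^esub> j"
  shows "((X, x), s, (B, b)) \<in> Arr EM" "((Y, y), t, (D, d)) \<in> Arr EM"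
proof -
  note arr = AX XY BD DF u v
  have typing: "s \<in> Arr C" "Dom C s = X" "Cod C s = B" "t \<in> Arr C" "Dom C t = Y" "Cod C t = D"
    using s t by (auto simp: hom_def)
  have typing': "e \<in> Arr C" "Dom C e = A" "Cod C e = X" "j \<in> Arr C" "Dom C j = X" "Cod C j = Y"
    "j' \<in> Arr C" "Dom C j' = B" "Cod C j' = D" "m \<in> Arr C" "Dom C m = D" "Cod C m = F"
    using arr by (simp_all add: Arr_EM_iff)
  have str: "x \<in> Arr C" "Dom C x = X" "Cod C x = ObjMap G X"
    "y \<in> Arr C" "Dom C y = Y" "Cod C y = ObjMap G Y"
    "a \<in> Arr C" "Dom C a = A" "Cod C a = ObjMap G A"
    "b \<in> Arr C" "Dom C b = B" "Cod C b = ObjMap G B"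
    "d \<in> Arr C" "Dom C d = D" "Cod C d = ObjMap G D"
    "f \<in> Arr C" "Dom C f = F" "Cod C f = ObjMap G F"
    using arr by (simp_all add: Arr_EM_iff coalgebras_iff)
  note typing = typing typing' str
  have nat: "x \<cdot>\<^bsub>C\<^esub> e = ArrMap G e \<cdot>\<^bsub>C\<^esub> a" "y \<cdot>\<^bsub>C\<^esub> j = ArrMap G j \<cdot>\<^bsub>C\<^esub> x"
    "d \<cdot>\<^bsub>C\<^esub> j' = ArrMap G j' \<cdot>\<^bsub>C\<^esub> b" "f \<cdot>\<^bsub>C\<^esub> m = ArrMap G m \<cdot>\<^bsub>C\<^esub> d"
    using arr by (simp_all add: Arr_EM_iff)
  \<comment> \<open>Facts 1 to 4 are the equations required by \<open>diagonal_unique\<close>: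
    agreement after \<open>e\<close>, compatibility of each pair with \<open>j\<close> and
    \<open>G j'\<close>, agreement under \<open>G m\<close>. The outer two come from
    \<open>u\<close> and \<open>v\<close> being coalgebra morphisms.\<close>
  have "b \<cdot>\<^bsub>C\<^esub> (s \<cdot>\<^bsub>C\<^esub> e) = ArrMap G (s \<cdot>\<^bsub>C\<^esub> e) \<cdot>\<^bsub>C\<^esub> a"
    using u by (simp add: Arr_EM_iff)
  also have "\<dots> = ArrMap G s \<cdot>\<^bsub>C\<^esub> (x \<cdot>\<^bsub>C\<^esub> e)"
    using typing by (simp add: nat)
  finally have 1: "(b \<cdot>\<^bsub>C\<^esub> s) \<cdot>\<^bsub>C\<^esub> e = (ArrMap G s \<cdot>\<^bsub>C\<^esub> x) \<cdot>\<^bsub>C\<^esub> e"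
    using typing by simp
  have 2: "ArrMap G j' \<cdot>\<^bsub>C\<^esub> (b \<cdot>\<^bsub>C\<^esub> s) = (d \<cdot>\<^bsub>C\<^esub> t) \<cdot>\<^bsub>C\<^esub> j"
    using Comp_reassoc[OF nat(3), of s] typing by (simp add: eq)
  have "ArrMap G j' \<cdot>\<^bsub>C\<^esub> ArrMap G s = ArrMap G t \<cdot>\<^bsub>C\<^esub> ArrMap G j"
    using arg_cong[OF eq, of "ArrMap G"] typing by simp
  then have 3: "ArrMap G j' \<cdot>\<^bsub>C\<^esub> (ArrMap G s \<cdot>\<^bsub>C\<^esub> x) = (ArrMap G t \<cdot>\<^bsub>C\<^esub> y) \<cdot>\<^bsub>C\<^esub> j"
    using Comp_reassoc[of "ArrMap G j'" "ArrMap G s" "ArrMap G t" "ArrMap G j" x] typing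
    by (simp add: nat)
  have "f \<cdot>\<^bsub>C\<^esub> (m \<cdot>\<^bsub>C\<^esub> t) = ArrMap G (m \<cdot>\<^bsub>C\<^esub> t) \<cdot>\<^bsub>C\<^esub> y"
    using v by (simp add: Arr_EM_iff)
  then have 4: "ArrMap G m \<cdot>\<^bsub>C\<^esub> (d \<cdot>\<^bsub>C\<^esub> t) = ArrMap G m \<cdot>\<^bsub>C\<^esub> (ArrMap G t \<cdot>\<^bsub>C\<^esub> y)"
    using Comp_reassoc[OF nat(4), of t] typing by simp
  have Gj': "ArrMap G j' \<in> \<J>" and Gm: "ArrMap G m \<in> \<M>"
    using G_\<J> G_\<M> BD DF by auto
  have "b \<cdot>\<^bsub>C\<^esub> s = ArrMap G s \<cdot>\<^bsub>C\<^esub> x" "d \<cdot>\<^bsub>C\<^esub> t = ArrMap G t \<cdot>\<^bsub>C\<^esub> y"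
    by (rule diagonal_unique[OF AX(2) _ XY(2) _ Gj' _ Gm _ _ _ _ _ 1 2 3 4];
        use typing in \<open>simp add: hom_def\<close>)+
  then show "((X, x), s, (B, b)) \<in> Arr EM" "((Y, y), t, (D, d)) \<in> Arr EM"
    using arr typing by (simp_all add: Arr_EM_iff)
qed

text \<open>The three equations of the filler \<open>x\<close>, \<open>y\<close> say that
  \<open>e\<close>, \<open>j\<close> and \<open>m\<close> are coalgebra morphisms. Each coalgebra
  law is an equality of two fillers: the counit law in a square ending in \<open>j\<close>,
  \<open>m\<close>, coassociativity in one ending in \<open>G (G j)\<close>,
  \<open>G (G m)\<close>.\<close>

lemma lift_factorization:
  assumes f: "((A, a), m \<cdot>\<^bsub>C\<^esub> (j \<cdot>\<^bsub>C\<^esub> e), (B, b)) \<in> Arr EM"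
    and e: "e \<in> \<E>" "e \<in> hom C A X" and j: "j \<in> \<J>" "j \<in> hom C X Y" and m: "m \<in> \<M>" "m \<in> hom C Y B"
  obtains x y where "((A, a), e, (X, x)) \<in> Arr EM" "((X, x), j, (Y, y)) \<in> Arr EM"
    "((Y, y), m, (B, b)) \<in> Arr EM"
proof -
  note [simp] = endo.ArrMap_Ident
  have cls: "ArrMap G j \<in> \<J>" "ArrMap G m \<in> \<M>"
    "ArrMap G (ArrMap G j) \<in> \<J>" "ArrMap G (ArrMap G m) \<in> \<M>"
    using G_\<J> G_\<M> j(1) m(1) by blast+
  have typing: "e \<in> Arr C" "Dom C e = A" "Cod C e = X" "j \<in> Arr C" "Dom C j = X" "Cod C j = Y"
    "m \<in> Arr C" "Dom C m = Y" "Cod C m = B"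
    "a \<in> Arr C" "Dom C a = A" "Cod C a = ObjMap G A"
    "b \<in> Arr C" "Dom C b = B" "Cod C b = ObjMap G B"
    using f e j m by (auto simp: hom_def Arr_EM_iff coalgebras_iff)
  have obj [simp]: "A \<in> Obj C" "X \<in> Obj C" "Y \<in> Obj C" "B \<in> Obj C"
    using hom_Obj e j m by blast+
  have laws: "\<epsilon> A \<cdot>\<^bsub>C\<^esub> a = Ident C A" "\<delta> A \<cdot>\<^bsub>C\<^esub> a = ArrMap G a \<cdot>\<^bsub>C\<^esub> a"
    "\<epsilon> B \<cdot>\<^bsub>C\<^esub> b = Ident C B" "\<delta> B \<cdot>\<^bsub>C\<^esub> b = ArrMap G b \<cdot>\<^bsub>C\<^esub> b"
    using f by (simp_all add: Arr_EM_iff coalgebras_iff)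
  \<comment> \<open>This square commutes because the composite
    \<open>m \<cdot> (j \<cdot> e)\<close> is a coalgebra morphism.\<close>
  have "(b \<cdot>\<^bsub>C\<^esub> m) \<cdot>\<^bsub>C\<^esub> (j \<cdot>\<^bsub>C\<^esub> e) = ArrMap G m \<cdot>\<^bsub>C\<^esub> (ArrMap G j \<cdot>\<^bsub>C\<^esub> (ArrMap G e \<cdot>\<^bsub>C\<^esub> a))"
    using f typing by (simp add: Arr_EM_iff)
  from diagonal[OF e j cls(1) _ cls(2) _ _ _ this, of "ObjMap G X" "ObjMap G Y" "ObjMap G B"]
  obtain x y where x: "x \<in> hom C X (ObjMap G X)" and y: "y \<in> hom C Y (ObjMap G Y)"
    and xe: "x \<cdot>\<^bsub>C\<^esub> e = ArrMap G e \<cdot>\<^bsub>C\<^esub> a" and jx: "ArrMap G j \<cdot>\<^bsub>C\<^esub> x = y \<cdot>\<^bsub>C\<^esub> j"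
    and my: "ArrMap G m \<cdot>\<^bsub>C\<^esub> y = b \<cdot>\<^bsub>C\<^esub> m"
    using typing by (auto simp: hom_def)
  have "x \<in> Arr C" "Dom C x = X" "Cod C x = ObjMap G X"
    "y \<in> Arr C" "Dom C y = Y" "Cod C y = ObjMap G Y"
    using x y by (auto simp: hom_def)
  note typing [simp] = typing this
  note eps = counit_natural[of e] counit_natural[of j] counit_natural[of m]
    and del = comult_natural[of e] comult_natural[of j] comult_natural[of m]
  have Gxe: "ArrMap G x \<cdot>\<^bsub>C\<^esub> ArrMap G e = ArrMap G (ArrMap G e) \<cdot>\<^bsub>C\<^esub> ArrMap G a"
    using arg_cong[OF xe, of "ArrMap G"] by simp
  have Gjx: "ArrMap G (ArrMap G j) \<cdot>\<^bsub>C\<^esub> ArrMap G x = ArrMap G y \<cdot>\<^bsub>C\<^esub> ArrMap G j"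
    using arg_cong[OF jx, of "ArrMap G"] by simp
  have Gmy: "ArrMap G (ArrMap G m) \<cdot>\<^bsub>C\<^esub> ArrMap G y = ArrMap G b \<cdot>\<^bsub>C\<^esub> ArrMap G m"
    using arg_cong[OF my, of "ArrMap G"] by simp
  have "\<epsilon> X \<cdot>\<^bsub>C\<^esub> x = Ident C X" "\<epsilon> Y \<cdot>\<^bsub>C\<^esub> y = Ident C Y"
  proof -
    \<comment> \<open>Naturality of \<open>\<epsilon>\<close> moves it along \<open>e\<close>,
      \<open>j\<close> and \<open>m\<close>; the counit laws of \<open>a\<close> and
      \<open>b\<close> then settle the two ends.\<close>
    have 1: "(\<epsilon> X \<cdot>\<^bsub>C\<^esub> x) \<cdot>\<^bsub>C\<^esub> e = Ident C X \<cdot>\<^bsub>C\<^esub> e"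
      using Comp_reassoc[OF eps(1), of a] by (simp add: xe laws)
    have 2: "j \<cdot>\<^bsub>C\<^esub> (\<epsilon> X \<cdot>\<^bsub>C\<^esub> x) = (\<epsilon> Y \<cdot>\<^bsub>C\<^esub> y) \<cdot>\<^bsub>C\<^esub> j"
      using Comp_reassoc[OF eps(2), of x] by (simp add: jx)
    have 3: "j \<cdot>\<^bsub>C\<^esub> Ident C X = Ident C Y \<cdot>\<^bsub>C\<^esub> j"
      by simp
    have 4: "m \<cdot>\<^bsub>C\<^esub> (\<epsilon> Y \<cdot>\<^bsub>C\<^esub> y) = m \<cdot>\<^bsub>C\<^esub> Ident C Y"
      using Comp_reassoc[OF eps(3), of y] Comp_assoc_Arr[of m b "\<epsilon> B"] by (simp add: my laws)
    show "\<epsilon> X \<cdot>\<^bsub>C\<^esub> x = Ident C X" "\<epsilon> Y \<cdot>\<^bsub>C\<^esub> y = Ident C Y"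
      by (rule diagonal_unique[OF e j j m _ _ _ _ 1 2 3 4]; simp add: hom_def)+
  qed
  moreover have "\<delta> X \<cdot>\<^bsub>C\<^esub> x = ArrMap G x \<cdot>\<^bsub>C\<^esub> x" "\<delta> Y \<cdot>\<^bsub>C\<^esub> y = ArrMap G y \<cdot>\<^bsub>C\<^esub> y"
  proof -
    have 1: "(\<delta> X \<cdot>\<^bsub>C\<^esub> x) \<cdot>\<^bsub>C\<^esub> e = (ArrMap G x \<cdot>\<^bsub>C\<^esub> x) \<cdot>\<^bsub>C\<^esub> e"
      using Comp_reassoc[OF del(1), of a] Comp_reassoc[OF Gxe, of a] by (simp add: xe laws)
    have 2: "ArrMap G (ArrMap G j) \<cdot>\<^bsub>C\<^esub> (\<delta> X \<cdot>\<^bsub>C\<^esub> x) = (\<delta> Y \<cdot>\<^bsub>C\<^esub> y) \<cdot>\<^bsub>C\<^esub> j"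
      using Comp_reassoc[OF del(2), of x] by (simp add: jx)
    have 3: "ArrMap G (ArrMap G j) \<cdot>\<^bsub>C\<^esub> (ArrMap G x \<cdot>\<^bsub>C\<^esub> x) = (ArrMap G y \<cdot>\<^bsub>C\<^esub> y) \<cdot>\<^bsub>C\<^esub> j"
      using Comp_reassoc[OF Gjx, of x] by (simp add: jx)
    \<comment> \<open>Naturality moves \<open>\<delta>\<close> from \<open>Y\<close> to
      \<open>B\<close>, where coassociativity of \<open>b\<close> is available; the defining
      equation of \<open>y\<close>, and its image under \<open>G\<close>, lead back to
      \<open>Y\<close>.\<close>
    have 4: "ArrMap G (ArrMap G m) \<cdot>\<^bsub>C\<^esub> (\<delta> Y \<cdot>\<^bsub>C\<^esub> y) = ArrMap G (ArrMap G m) \<cdot>\<^bsub>C\<^esub> (ArrMap G y \<cdot>\<^bsub>C\<^esub> y)"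
    proof -
      have "ArrMap G (ArrMap G m) \<cdot>\<^bsub>C\<^esub> (\<delta> Y \<cdot>\<^bsub>C\<^esub> y) = (\<delta> B \<cdot>\<^bsub>C\<^esub> b) \<cdot>\<^bsub>C\<^esub> m"
        using Comp_reassoc[OF del(3), of y] by (simp add: my)
      also have "\<dots> = ArrMap G b \<cdot>\<^bsub>C\<^esub> (ArrMap G m \<cdot>\<^bsub>C\<^esub> y)"
        unfolding laws(4) by (simp add: my)
      also have "\<dots> = ArrMap G (ArrMap G m) \<cdot>\<^bsub>C\<^esub> (ArrMap G y \<cdot>\<^bsub>C\<^esub> y)"
        using Comp_reassoc[OF Gmy, of y] by simp
      finally show ?thesis .
    qed
    show "\<delta> X \<cdot>\<^bsub>C\<^esub> x = ArrMap G x \<cdot>\<^bsub>C\<^esub> x" "\<delta> Y \<cdot>\<^bsub>C\<^esub> y = ArrMap G y \<cdot>\<^bsub>C\<^esub> y"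
      by (rule diagonal_unique[OF e j cls(3) _ cls(4) _ _ _ _ _ 1 2 3 4]; simp add: hom_def)+
  qed
  ultimately have "(X, x) \<in> coalgebras C G \<epsilon> \<delta>" "(Y, y) \<in> coalgebras C G \<epsilon> \<delta>"
    by (simp_all add: coalgebras_iff)
  then show ?thesis
    using that[of x y] f xe jx my by (simp add: Arr_EM_iff)
qed

section \<open>The lifted double factorization system\<close>

abbreviation "\<E>\<^sub>G \<equiv> arr_preimage EM U \<E>"
abbreviation "\<J>\<^sub>G \<equiv> arr_preimage EM U \<J>"
abbreviation "\<M>\<^sub>G \<equiv> arr_preimage EM U \<M>"

lemma arr_preimage_U_iff: "(X, f, Y) \<in> arr_preimage EM U \<A> \<longleftrightarrow> (X, f, Y) \<in> Arr EM \<and> f \<in> \<A>"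
  by (simp add: arr_preimage_def)

lemma class_comp_subset_arr_preimage:
  assumes "\<A> \<subseteq> Arr EM" "\<B> \<subseteq> Arr EM" "class_comp C (ArrMap U ` \<B>) (ArrMap U ` \<A>) \<subseteq> \<X>"
  shows "class_comp EM \<B> \<A> \<subseteq> arr_preimage EM U \<X>"
  using U.class_comp_image[OF assms(1,2)] assms EM.class_comp_subset_Arr[OF assms(1,2)]
  unfolding arr_preimage_def by blast

text \<open>Axiom (1) pulls back because functors preserve isomorphisms and composites, and axiom
  (2) is \<open>lift_factorization\<close>. For axiom (3) the fillers are found in \<open>C\<close>
  and lifted by \<open>lift_diagonal\<close>; they stay unique because a coalgebra morphism is
  determined by its ends and its underlying arrow.\<close>

sublocale EM: double_factorization_system EM \<E>\<^sub>G \<J>\<^sub>G \<M>\<^sub>G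
proof
  have pre: "arr_preimage EM U \<X> \<subseteq> Arr EM" for \<X> unfolding arr_preimage_def by auto
  have isos: "isos EM \<subseteq> Arr EM" unfolding isos_def by auto
  show "\<E>\<^sub>G \<subseteq> Arr EM" "\<J>\<^sub>G \<subseteq> Arr EM" "\<M>\<^sub>G \<subseteq> Arr EM" by (rule pre)+
  note img = U.arr_preimage_image
  show "class_comp EM (isos EM) \<E>\<^sub>G \<subseteq> \<E>\<^sub>G"
    using class_comp_mono[OF img U.isos_image] iso_\<E> by (intro class_comp_subset_arr_preimage pre isos) blast
  show "class_comp EM \<M>\<^sub>G (isos EM) \<subseteq> \<M>\<^sub>G"
    using class_comp_mono[OF U.isos_image img] \<M>_iso by (intro class_comp_subset_arr_preimage pre isos) blast
  show "class_comp EM (isos EM) (class_comp EM \<J>\<^sub>G (isos EM)) \<subseteq> \<J>\<^sub>G"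
  proof (intro class_comp_subset_arr_preimage EM.class_comp_subset_Arr pre isos)
    have "ArrMap U ` class_comp EM \<J>\<^sub>G (isos EM) \<subseteq> class_comp C \<J> (isos C)"
      using U.class_comp_image[OF isos pre] class_comp_mono[OF U.isos_image img] by blast
    then show "class_comp C (ArrMap U ` isos EM) (ArrMap U ` class_comp EM \<J>\<^sub>G (isos EM)) \<subseteq> \<J>"
      using class_comp_mono[OF _ U.isos_image] iso_\<J>_iso by blast
  qed
  show "Arr EM \<subseteq> class_comp EM \<M>\<^sub>G (class_comp EM \<J>\<^sub>G \<E>\<^sub>G)"
  proof
    fix \<phi> assume \<phi>: "\<phi> \<in> Arr EM"
    obtain A a f B b where \<phi>_eq: "\<phi> = ((A, a), f, (B, b))" by (metis prod.exhaust)
    have "f \<in> hom C A B" using \<phi> by (simp add: \<phi>_eq Arr_EM_iff hom_def)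
    then obtain e j m X Y where e: "e \<in> \<E>" "e \<in> hom C A X"
      and j: "j \<in> \<J>" "j \<in> hom C X Y" and m: "m \<in> \<M>" "m \<in> hom C Y B" and f: "f = m \<cdot>\<^bsub>C\<^esub> (j \<cdot>\<^bsub>C\<^esub> e)"
      by (rule factorE)
    obtain x y where e': "((A, a), e, (X, x)) \<in> Arr EM" and j': "((X, x), j, (Y, y)) \<in> Arr EM"
      and m': "((Y, y), m, (B, b)) \<in> Arr EM"
      by (rule lift_factorization[OF \<phi>[unfolded \<phi>_eq f] e j m])
    have "((X, x), j, (Y, y)) \<cdot>\<^bsub>EM\<^esub> ((A, a), e, (X, x)) \<in> class_comp EM \<J>\<^sub>G \<E>\<^sub>G"
      using e' j' e j by (intro EM.class_compI) (simp_all add: arr_preimage_U_iff hom_EM_iff)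
    then have "((Y, y), m, (B, b)) \<cdot>\<^bsub>EM\<^esub> (((X, x), j, (Y, y)) \<cdot>\<^bsub>EM\<^esub> ((A, a), e, (X, x)))
        \<in> class_comp EM \<M>\<^sub>G (class_comp EM \<J>\<^sub>G \<E>\<^sub>G)"
      unfolding class_comp_def[of EM \<M>\<^sub>G] using m' m by (fastforce simp: arr_preimage_U_iff)
    then show "\<phi> \<in> class_comp EM \<M>\<^sub>G (class_comp EM \<J>\<^sub>G \<E>\<^sub>G)"
      by (simp add: \<phi>_eq f)
  qed
next
  fix e X1 X2 j X3 j' Y1 Y2 m Y3 u v
  assume "e \<in> \<E>\<^sub>G" and e_hom: "e \<in> hom EM X1 X2" and "j \<in> \<J>\<^sub>G" and j_hom: "j \<in> hom EM X2 X3"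
    and "j' \<in> \<J>\<^sub>G" and j'_hom: "j' \<in> hom EM Y1 Y2" and "m \<in> \<M>\<^sub>G" and m_hom: "m \<in> hom EM Y2 Y3"
    and u_hom: "u \<in> hom EM X1 Y1" and v_hom: "v \<in> hom EM X3 Y3"
    and eq: "v \<cdot>\<^bsub>EM\<^esub> (j \<cdot>\<^bsub>EM\<^esub> e) = m \<cdot>\<^bsub>EM\<^esub> (j' \<cdot>\<^bsub>EM\<^esub> u)"
  then obtain e0 j0 j0' m0 u0 v0 where
      e: "e = (X1, e0, X2)" "(X1, e0, X2) \<in> Arr EM" "e0 \<in> \<E>"
      and j: "j = (X2, j0, X3)" "(X2, j0, X3) \<in> Arr EM" "j0 \<in> \<J>"
      and j': "j' = (Y1, j0', Y2)" "(Y1, j0', Y2) \<in> Arr EM" "j0' \<in> \<J>"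
      and m: "m = (Y2, m0, Y3)" "(Y2, m0, Y3) \<in> Arr EM" "m0 \<in> \<M>"
      and u: "u = (X1, u0, Y1)" "(X1, u0, Y1) \<in> Arr EM"
      and v: "v = (X3, v0, Y3)" "(X3, v0, Y3) \<in> Arr EM"
    unfolding hom_EM_iff by (auto simp: arr_preimage_U_iff)
  have under: "(X, f, Y) \<in> Arr EM \<Longrightarrow> f \<in> hom C (fst X) (fst Y)" for X f Y
    by (simp add: Arr_EM_iff hom_def)
  have "v0 \<cdot>\<^bsub>C\<^esub> (j0 \<cdot>\<^bsub>C\<^esub> e0) = m0 \<cdot>\<^bsub>C\<^esub> (j0' \<cdot>\<^bsub>C\<^esub> u0)"
    using eq by (simp add: e j j' m u v)
  from diagonal[OF e(3) under[OF e(2)] j(3) under[OF j(2)] j'(3) under[OF j'(2)]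
      m(3) under[OF m(2)] under[OF u(2)] under[OF v(2)] this]
  obtain s t where s: "s \<in> hom C (fst X2) (fst Y1)" and t: "t \<in> hom C (fst X3) (fst Y2)"
    and st: "s \<cdot>\<^bsub>C\<^esub> e0 = u0" "j0' \<cdot>\<^bsub>C\<^esub> s = t \<cdot>\<^bsub>C\<^esub> j0" "m0 \<cdot>\<^bsub>C\<^esub> t = v0"
    by blast
  \<comment> \<open>The outer composites are \<open>u0\<close> and \<open>v0\<close>, which underlie
    coalgebra morphisms, as \<open>lift_diagonal\<close> requires.\<close>
  have st_arr: "(X2, s, Y1) \<in> Arr EM" "(X3, t, Y2) \<in> Arr EM"
    using lift_diagonal[where a = "snd X1" and A = "fst X1" and x = "snd X2" and X = "fst X2"
        and y = "snd X3" and Y = "fst X3" and b = "snd Y1" and B = "fst Y1"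
        and d = "snd Y2" and D = "fst Y2" and f = "snd Y3" and F = "fst Y3"
        and e = e0 and j = j0 and j' = j0' and m = m0 and s = s and t = t]
      e j j' m u v s t st by auto
  show "\<exists>!(s, t). s \<in> hom EM X2 Y1 \<and> t \<in> hom EM X3 Y2 \<and>
      s \<cdot>\<^bsub>EM\<^esub> e = u \<and> j' \<cdot>\<^bsub>EM\<^esub> s = t \<cdot>\<^bsub>EM\<^esub> j \<and> m \<cdot>\<^bsub>EM\<^esub> t = v"
  proof (rule ex1I[of _ "((X2, s, Y1), (X3, t, Y2))"])
    show "case ((X2, s, Y1), (X3, t, Y2)) of (s, t) \<Rightarrow> s \<in> hom EM X2 Y1 \<and> t \<in> hom EM X3 Y2 \<and>
        s \<cdot>\<^bsub>EM\<^esub> e = u \<and> j' \<cdot>\<^bsub>EM\<^esub> s = t \<cdot>\<^bsub>EM\<^esub> j \<and> m \<cdot>\<^bsub>EM\<^esub> t = v"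
      using st_arr st by (simp add: hom_EM_iff e j j' m u v)
  next
    fix p
    assume "case p of (s, t) \<Rightarrow> s \<in> hom EM X2 Y1 \<and> t \<in> hom EM X3 Y2 \<and>
        s \<cdot>\<^bsub>EM\<^esub> e = u \<and> j' \<cdot>\<^bsub>EM\<^esub> s = t \<cdot>\<^bsub>EM\<^esub> j \<and> m \<cdot>\<^bsub>EM\<^esub> t = v"
    then obtain s' t' where p: "p = ((X2, s', Y1), (X3, t', Y2))"
      and arr: "(X2, s', Y1) \<in> Arr EM" "(X3, t', Y2) \<in> Arr EM"
      and st': "s' \<cdot>\<^bsub>C\<^esub> e0 = u0" "j0' \<cdot>\<^bsub>C\<^esub> s' = t' \<cdot>\<^bsub>C\<^esub> j0" "m0 \<cdot>\<^bsub>C\<^esub> t' = v0"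
      by (cases p) (auto simp: hom_EM_iff e j j' m u v)
    have "s' = s" "t' = t"
      by (rule diagonal_unique[OF e(3) under[OF e(2)] j(3) under[OF j(2)] j'(3) under[OF j'(2)]
            m(3) under[OF m(2)] under[OF arr(1)] s under[OF arr(2)] t]; simp add: st st')+
    then show "p = ((X2, s, Y1), (X3, t, Y2))" using p by simp
  qed
qed

text \<open>To lift a factorization \<open>j \<cdot> e\<close>, read it as a threefold factorization
  whose last factor is the identity, a member of \<open>\<M>\<close>, and apply
  \<open>lift_factorization\<close>.\<close>

lemma arr_preimage_class_comp:
  "arr_preimage EM U (class_comp C \<J> \<E>) = class_comp EM \<J>\<^sub>G \<E>\<^sub>G"
proof
  show "class_comp EM \<J>\<^sub>G \<E>\<^sub>G \<subseteq> arr_preimage EM U (class_comp C \<J> \<E>)"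
    by (rule U.class_comp_arr_preimage)
  show "arr_preimage EM U (class_comp C \<J> \<E>) \<subseteq> class_comp EM \<J>\<^sub>G \<E>\<^sub>G"
  proof
    fix \<phi> assume \<phi>: "\<phi> \<in> arr_preimage EM U (class_comp C \<J> \<E>)"
    obtain A a f B b where \<phi>_eq: "\<phi> = ((A, a), f, (B, b))" by (metis prod.exhaust)
    have arr: "((A, a), f, (B, b)) \<in> Arr EM" and f: "f \<in> class_comp C \<J> \<E>"
      using \<phi> by (simp_all add: \<phi>_eq arr_preimage_U_iff)
    obtain e j where fje: "f = j \<cdot>\<^bsub>C\<^esub> e" and e: "e \<in> \<E>" "e \<in> hom C (Dom C e) (Dom C j)"
      and j: "j \<in> \<J>" "j \<in> hom C (Dom C j) (Cod C j)"
      by (rule class_compE[OF f \<E>_subset \<J>_subset])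
    have typing: "e \<in> Arr C" "Cod C e = Dom C j" "j \<in> Arr C"
      "a \<in> Arr C" "Dom C a = A" "b \<in> Arr C" "Dom C b = B" "Cod C b = ObjMap G B"
      "Dom C e = A" "Cod C j = B"
      using e j arr by (auto simp: hom_def fje Arr_EM_iff coalgebras_iff)
    have B: "B \<in> Obj C" using arr by (simp add: Arr_EM_iff coalgebras_iff)
    have "((A, a), Ident C B \<cdot>\<^bsub>C\<^esub> (j \<cdot>\<^bsub>C\<^esub> e), (B, b)) \<in> Arr EM"
      using arr typing by (simp add: fje)
    from lift_factorization[OF this e(1) _ j(1) _ Ident_in_classes(2)[OF B] Ident_in_hom[OF B]]
    obtain x y where e': "((A, a), e, (Dom C j, x)) \<in> Arr EM"
      and j': "((Dom C j, x), j, (B, y)) \<in> Arr EM" and i: "((B, y), Ident C B, (B, b)) \<in> Arr EM"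
      using e j typing by auto
    \<comment> \<open>The identity of \<open>B\<close> is a coalgebra morphism between the lifted
      structure \<open>y\<close> and the given \<open>b\<close>, which forces them to
      coincide.\<close>
    have "y = b"
      using i typing B by (auto simp: Arr_EM_iff coalgebras_iff endo.ArrMap_Ident)
    then have "((Dom C j, x), j, (B, b)) \<cdot>\<^bsub>EM\<^esub> ((A, a), e, (Dom C j, x)) \<in> class_comp EM \<J>\<^sub>G \<E>\<^sub>G"
      using e' j' e j by (intro EM.class_compI) (simp_all add: arr_preimage_U_iff hom_EM_iff)
    then show "\<phi> \<in> class_comp EM \<J>\<^sub>G \<E>\<^sub>G" by (simp add: \<phi>_eq fje)
  qed
qed

text \<open>By \<open>arr_preimage_class_comp\<close> the third induced class is the right
  orthogonal class of \<open>\<J>\<^sub>G\<close> composed with \<open>\<E>\<^sub>G\<close>, and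
  \<open>\<M>_eq_right_perp\<close> in the coalgebra category identifies that with
  \<open>\<M>\<^sub>G\<close>.\<close>

lemma left_induced_EM:
  "left_induced_dfs EM C U R (cofree_unit G \<delta>) \<epsilon> \<E> \<J> \<M> \<E>\<^sub>G \<J>\<^sub>G \<M>\<^sub>G"
  unfolding left_induced_dfs_def arr_preimage_class_comp
  using adjunction_cofree double_factorization_system_axioms EM.\<M>_eq_right_perp
    EM.double_factorization_system_axioms by simp

lemma quillen_EM: "quillen_adjunction EM \<E>\<^sub>G \<J>\<^sub>G \<M>\<^sub>G C \<E> \<J> \<M> U R (cofree_unit G \<delta>) \<epsilon>"
proof (intro quillen_adjunction.intro quillen_adjunction_axioms.intro adjunction_cofree
    double_factorization_system_axioms EM.double_factorization_system_axioms)
  show "ArrMap U ` class_comp EM \<J>\<^sub>G \<E>\<^sub>G \<subseteq> class_comp C \<J> \<E>"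
    unfolding arr_preimage_class_comp[symmetric] by (rule U.arr_preimage_image)
  show "ArrMap U ` \<E>\<^sub>G \<subseteq> \<E>" by (rule U.arr_preimage_image)
qed

section \<open>The terminal coalgebra and local objects\<close>

lemma terminal_R:
  assumes GT: "terminal C (ObjMap G T)" and GGT: "terminal C (ObjMap G (ObjMap G T))"
    and T: "T \<in> Obj C"
  shows "terminal EM (ObjMap R T)"
  unfolding terminal_def
proof (intro conjI ballI)
  show R: "ObjMap R T \<in> Obj EM" using T by (rule R.ObjMap_in_Obj)
  fix X assume X: "X \<in> Obj EM"
  then obtain A a where X_eq: "X = (A, a)" and A: "A \<in> Obj C"
    and a: "a \<in> Arr C" "Dom C a = A" "Cod C a = ObjMap G A"
    by (cases X) (auto simp: coalgebras_iff)
  obtain f where f: "f \<in> hom C A (ObjMap G T)" using GT A unfolding terminal_def by blast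
  \<comment> \<open>Both sides are arrows into the terminal object \<open>G (G T)\<close>, so the
    underlying arrow to \<open>G T\<close> is automatically a coalgebra morphism.\<close>
  have "\<delta> T \<cdot>\<^bsub>C\<^esub> f = ArrMap G f \<cdot>\<^bsub>C\<^esub> a"
    by (rule terminal_unique[OF GGT A]) (use f a T in \<open>auto simp: hom_def\<close>)
  then have "(X, f, ObjMap R T) \<in> hom EM X (ObjMap R T)"
    using f X R unfolding X_eq by (simp add: hom_EM_iff Arr_EM_iff hom_def)
  moreover have "\<phi> = (X, f, ObjMap R T)" if \<phi>: "\<phi> \<in> hom EM X (ObjMap R T)" for \<phi>
  proof -
    obtain g where "\<phi> = (X, g, ObjMap R T)" and "(X, g, ObjMap R T) \<in> Arr EM"
      using \<phi> unfolding hom_EM_iff by blast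
    then show ?thesis
      using terminal_unique[OF GT A _ f, of g] by (simp add: Arr_EM_iff X_eq hom_def)
  qed
  ultimately show "\<exists>!\<phi>. \<phi> \<in> hom EM X (ObjMap R T)" by blast
qed

text \<open>Preservation is assumed for every terminal object because it is applied to
  \<open>T\<close> and again to \<open>G T\<close>.\<close>

context
  fixes T
  assumes T: "terminal C T" and G_terminal: "\<And>T'. terminal C T' \<Longrightarrow> terminal C (ObjMap G T')"
begin

text \<open>The arrow from \<open>X\<close> to the terminal coalgebra \<open>R T\<close> lies over
  an arrow to \<open>G T\<close>, which is terminal in \<open>C\<close>. The first is in
  \<open>\<M>\<^sub>G\<close> exactly when the second is in \<open>\<M>\<close>, so
  \<open>local_objects_iff\<close> applies on both levels.\<close>

lemma local_EM_iff:
  assumes X: "X \<in> Obj EM"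
  shows "X \<in> local_objects EM (class_comp EM \<J>\<^sub>G \<E>\<^sub>G) \<longleftrightarrow> fst X \<in> local_objects C (class_comp C \<J> \<E>)"
proof -
  have RT: "terminal EM (ObjMap R T)"
    using T G_terminal by (intro terminal_R) (auto simp: terminal_def)
  obtain \<phi> where \<phi>: "\<phi> \<in> hom EM X (ObjMap R T)" using RT X unfolding terminal_def by blast
  have U\<phi>: "ArrMap U \<phi> \<in> hom C (fst X) (ObjMap G T)" using U.ArrMap_in_hom[OF \<phi>] by simp
  have "\<phi> \<in> \<M>\<^sub>G \<longleftrightarrow> ArrMap U \<phi> \<in> \<M>"
    using \<phi> unfolding arr_preimage_def by (simp add: hom_def)
  then show ?thesis
    unfolding EM.local_objects_iff[OF RT \<phi>] local_objects_iff[OF G_terminal[OF T] U\<phi>] .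
qed

text \<open>If \<open>q\<close> from \<open>A\<close> to \<open>T\<close> is in \<open>\<M>\<close>,
  then so is \<open>G q\<close>, and its codomain \<open>G T\<close> is again terminal.\<close>

lemma G_local:
  assumes A: "A \<in> local_objects C (class_comp C \<J> \<E>)"
  shows "ObjMap G A \<in> local_objects C (class_comp C \<J> \<E>)"
proof -
  have "A \<in> Obj C" using A unfolding local_objects_def by simp
  then obtain q where q: "q \<in> hom C A T" using T unfolding terminal_def by blast
  then have "q \<in> \<M>" using local_objects_iff[OF T] A by blast
  then show ?thesis
    using local_objects_iff[OF G_terminal[OF T] endo.ArrMap_in_hom[OF q]] G_\<M> by blast
qed

lemma U_local_preimage:
  "obj_preimage EM U (local_objects C (class_comp C \<J> \<E>))
    \<subseteq> local_objects EM (class_comp EM \<J>\<^sub>G \<E>\<^sub>G)"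
proof
  fix X assume "X \<in> obj_preimage EM U (local_objects C (class_comp C \<J> \<E>))"
  then have "X \<in> Obj EM" "fst X \<in> local_objects C (class_comp C \<J> \<E>)"
    unfolding obj_preimage_def by simp_all
  then show "X \<in> local_objects EM (class_comp EM \<J>\<^sub>G \<E>\<^sub>G)"
    using local_EM_iff by blast
qed

lemma U_local:
  "ObjMap U ` local_objects EM (class_comp EM \<J>\<^sub>G \<E>\<^sub>G) \<subseteq> local_objects C (class_comp C \<J> \<E>)"
proof (rule image_subsetI)
  fix X assume X: "X \<in> local_objects EM (class_comp EM \<J>\<^sub>G \<E>\<^sub>G)"
  then have "X \<in> Obj EM" unfolding local_objects_def by blast
  then show "ObjMap U X \<in> local_objects C (class_comp C \<J> \<E>)"
    using local_EM_iff X unfolding U_simps by blast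
qed

text \<open>The object underlying \<open>R A\<close> is \<open>G A\<close>, so
  \<open>local_EM_iff\<close> reduces the claim to \<open>G_local\<close>.\<close>

lemma R_local:
  "ObjMap R ` local_objects C (class_comp C \<J> \<E>) \<subseteq> local_objects EM (class_comp EM \<J>\<^sub>G \<E>\<^sub>G)"
proof
  fix X assume "X \<in> ObjMap R ` local_objects C (class_comp C \<J> \<E>)"
  then obtain A where X: "X = ObjMap R A" and A: "A \<in> local_objects C (class_comp C \<J> \<E>)"
    by blast
  have "X \<in> Obj EM" using A R.ObjMap_in_Obj unfolding X local_objects_def by blast
  then show "X \<in> local_objects EM (class_comp EM \<J>\<^sub>G \<E>\<^sub>G)"
    using local_EM_iff G_local[OF A] X by simp
qed

end

end

theorem proposition2:
  fixes C :: "('o, 'm) category"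
    and \<E> \<J> \<M> :: "'m set"
    and G :: "('o, 'm, 'o, 'm) funct"
    and \<epsilon> \<delta> :: "'o \<Rightarrow> 'm"
    and C\<^sub>G :: "('o \<times> 'm, ('o \<times> 'm) \<times> 'm \<times> ('o \<times> 'm)) category"
    and U :: "('o \<times> 'm, ('o \<times> 'm) \<times> 'm \<times> ('o \<times> 'm), 'o, 'm) funct"
    and R :: "('o, 'm, 'o \<times> 'm, ('o \<times> 'm) \<times> 'm \<times> ('o \<times> 'm)) funct"
    and \<eta> :: "'o \<times> 'm \<Rightarrow> ('o \<times> 'm) \<times> 'm \<times> ('o \<times> 'm)"
    and \<E>\<^sub>G \<J>\<^sub>G \<M>\<^sub>G :: "(('o \<times> 'm) \<times> 'm \<times> ('o \<times> 'm)) set"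
  assumes dfs: "double_factorization_system C \<E> \<J> \<M>"
    and comonad: "comonad C G \<epsilon> \<delta>"
    and limits: "(bicomplete TYPE('u) C \<and> preserves_small_limits TYPE('u) C C G) \<or>
                 (finitely_bicomplete C \<and> preserves_finite_limits C C G)"
    and G_\<M>: "ArrMap G ` \<M> \<subseteq> \<M>"
    and G_\<J>: "ArrMap G ` \<J> \<subseteq> \<J>"
    and C\<^sub>G: "C\<^sub>G = coalgebra_category C G \<epsilon> \<delta>"
    and U: "U = forgetful_functor"
    and R: "R = cofree_functor C G \<delta>"
    and \<eta>: "\<eta> = cofree_unit G \<delta>"
    and \<E>\<^sub>G: "\<E>\<^sub>G = arr_preimage C\<^sub>G U \<E>"
    and \<J>\<^sub>G: "\<J>\<^sub>G = arr_preimage C\<^sub>G U \<J>"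
    and \<M>\<^sub>G: "\<M>\<^sub>G = arr_preimage C\<^sub>G U \<M>"
  shows "left_induced_dfs C\<^sub>G C U R \<eta> \<epsilon> \<E> \<J> \<M> \<E>\<^sub>G \<J>\<^sub>G \<M>\<^sub>G \<and>
    obj_preimage C\<^sub>G U (local_objects C (class_comp C \<J> \<E>))
      \<subseteq> local_objects C\<^sub>G (class_comp C\<^sub>G \<J>\<^sub>G \<E>\<^sub>G) \<and>
    ((ObjMap U ` local_objects C\<^sub>G (class_comp C\<^sub>G \<J>\<^sub>G \<E>\<^sub>G)
        \<subseteq> local_objects C (class_comp C \<J> \<E>) \<and>
      ObjMap R ` local_objects C (class_comp C \<J> \<E>)
        \<subseteq> local_objects C\<^sub>G (class_comp C\<^sub>G \<J>\<^sub>G \<E>\<^sub>G))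
     \<longleftrightarrow> ObjMap G ` local_objects C (class_comp C \<J> \<E>) \<subseteq> local_objects C (class_comp C \<J> \<E>)) \<and>
    quillen_adjunction C\<^sub>G \<E>\<^sub>G \<J>\<^sub>G \<M>\<^sub>G C \<E> \<J> \<M> U R \<eta> \<epsilon>"
proof -
  interpret dfs_comonad C G \<epsilon> \<delta> \<E> \<J> \<M>
    using dfs comonad G_\<M> G_\<J> by (intro dfs_comonad.intro dfs_comonad_axioms.intro)
  obtain T where T: "terminal C T" using preserved_terminal_objects(1)[OF limits] by blast
  note terminals = T preserved_terminal_objects(2)[OF limits]
  \<comment> \<open>The right side of the equivalence in (iii) holds by \<open>G_local\<close>, and
    both inclusions on its left by \<open>U_local\<close> and \<open>R_local\<close>; the
    equivalence follows since both sides are true.\<close>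
  have "ObjMap G ` local_objects C (class_comp C \<J> \<E>) \<subseteq> local_objects C (class_comp C \<J> \<E>)"
    using G_local[OF terminals] by blast
  then show ?thesis
    unfolding C\<^sub>G U R \<eta> \<E>\<^sub>G \<J>\<^sub>G \<M>\<^sub>G
    using left_induced_EM quillen_EM U_local_preimage[OF terminals] U_local[OF terminals]
      R_local[OF terminals] by blast
qed

end
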